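(* Let $n\ge 2$ be an integer, $\epsilon\in\{-1,1\}$, and let $\mathscr F_\epsilon=\{\Sigma_H : H>C_\epsilon\}$ be the family of rotational constant mean curvature spheres of $\mathbb Q_\epsilon^n\times\mathbb R$ described in the context. Then the following hold. A) For $\epsilon=-1$ (that is, in $\mathbb H^n\times\mathbb R$), the whole family $\mathscr F_{-1}$ is nested: $\Omega_H\subset\Omega_{H^*}$ whenever $H>H^*>n-1$. B) For $\epsilon=1$ (that is, in $\mathbb S^n\times\mathbb R$), there exists $C_{\min}>0$ such that, for $C\ge 0$, the subfamily $\mathscr F_C=\{\Sigma_H : H>C\}$ of $\mathscr F_1$ is nested if and only if $C\ge C_{\min}$. Furthermore, as $H$ decreases to $0$, the height of $\Sigma_H$ (measured by the height of its horizontal hyperplane of symmetry $P_H$) strictly decreases to $0$ (i.e. for $H$ in some interval $(0,\eta)$, $\eta>0$, it is strictly increasing as a function of $H$, and it tends to $0$ as $H\to0$), and $\Sigma_H$ converges uniformly to (a double copy of) the totally geodesic horizontal hyperplane $\mathbb S^n\times\{0\}$.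
   Context: $\mathbb Q_\epsilon^n$ is the simply connected $n$-dimensional space form of constant sectional curvature $\epsilon$: $\mathbb Q_{-1}^n=\mathbb H^n$, $\mathbb Q_1^n=\mathbb S^n$. Mean curvature is nonnormalized: the sum of the principal curvatures (trace of the shape operator). Set $C_{-1}:=n-1$ and $C_1:=0$; $\mathcal R_{-1}:=+\infty$, $\mathcal R_1:=\pi$; $\sin_{1}=\sin$, $\sin_{-1}=\sinh$. For each $H>C_\epsilon$ there is, up to congruence, exactly one embedded rotational sphere $\Sigma_H$ of constant mean curvature $H$ in $\mathbb Q_\epsilon^n\times\mathbb R$. Fix $o\in\mathbb Q_\epsilon^n\times\{0\}$; the spheres $\Sigma_H$ of $\mathscr F_\epsilon$ are positioned so that all have the same rotational axis $\{o\}\times\mathbb R$ and the same point $o$ of minimal height. Explicitly, let $\varphi_\epsilon(0)=0$ and $\varphi_\epsilon(s)=\frac{1}{\sin_\epsilon^{n-1}(s)}\int_0^s\sin_\epsilon^{n-1}(u)\,du$ for $s\in(0,\mathcal R_\epsilon)$. Given $H>C_\epsilon$, let $s_0=s_0(H)\in(0,\mathcal R_\epsilon)$ be the unique number with $\varphi_\epsilon(s_0)=1/H$ (the radius of $\Sigma_H$), and put $$\phi(s)=\int_0^s\frac{H\varphi_\epsilon(u)}{\sqrt{1-H^2\varphi_\epsilon^2(u)}}\,du,\qquad s\in[0,s_0].$$ Then the lower hemisphere $\Sigma_H^-$ is the radial graph $\{(x,\phi(d(o,x)))\}$ over the open geodesic ball $B(o,s_0)\subset\mathbb Q_\epsilon^n$,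 and $\Sigma_H$ is the union of the closure of $\Sigma_H^-$ with its reflection about the horizontal hyperplane of symmetry $P_H=\mathbb Q_\epsilon^n\times\{\phi(s_0)\}$. $\Omega_H$ denotes the compact region of $\mathbb Q_\epsilon^n\times\mathbb R$ enclosed by $\Sigma_H$. For $C\ge C_\epsilon$, the subfamily $\mathscr F_C:=\{\Sigma_H : H>C\}\subset\mathscr F_\epsilon$ is called nested if $\Omega_H\subset\Omega_{H^*}$ whenever $H>H^*>C$. *)

theory Defs
  imports "HOL-Analysis.Analysis"
begin

text \<open>
  Throughout, \<open>eps\<close> is meant to be \<open>1\<close> or \<open>-1\<close>, and the dimension \<open>n\<close> of the space form is
  \<open>CARD('n)\<close>.  Space forms are realised in the standard linear models inside
  \<open>real ^ 'n \<times> real\<close>: the unit sphere, and the upper sheet of the hyperboloid in Minkowski space,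
  both being given by the same quadratic equation for the form below.
\<close>

definition qform :: "int \<Rightarrow> (real ^ 'n::finite) \<times> real \<Rightarrow> (real ^ 'n) \<times> real \<Rightarrow> real" where
  "qform eps x y = fst x \<bullet> fst y + of_int eps * (snd x * snd y)"

definition space_form :: "int \<Rightarrow> ((real ^ 'n::finite) \<times> real) set" where
  "space_form eps = {x. qform eps x x = of_int eps \<and> (eps = -1 \<longrightarrow> snd x > 0)}"

text \<open>
  The Riemannian (geodesic) distance in these models.  The \<open>dist\<close> of the ambient type is the
  chordal one and is not used for geodesic balls.
\<close>

definition geo_dist :: "int \<Rightarrow> (real ^ 'n::finite) \<times> real \<Rightarrow> (real ^ 'n) \<times> real \<Rightarrow> real" where
  "geo_dist eps x y = (if eps = 1 then arccos (qform eps x y) else arcosh (- qform eps x y))"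

definition geo_ball :: "int \<Rightarrow> (real ^ 'n::finite) \<times> real \<Rightarrow> real \<Rightarrow> ((real ^ 'n) \<times> real) set" where
  "geo_ball eps p r = {x \<in> space_form eps. geo_dist eps p x < r}"

definition sin_eps :: "int \<Rightarrow> real \<Rightarrow> real" where
  "sin_eps eps = (if eps = 1 then sin else sinh)"

definition C_eps :: "nat \<Rightarrow> int \<Rightarrow> real" where
  "C_eps n eps = (if eps = 1 then 0 else real n - 1)"

definition R_eps :: "int \<Rightarrow> ereal" where
  "R_eps eps = (if eps = 1 then ereal pi else \<infinity>)"

definition phi_eps :: "nat \<Rightarrow> int \<Rightarrow> real \<Rightarrow> real" where
  "phi_eps n eps s =
     (if s = 0 then 0
      else 1 / sin_eps eps s ^ (n - 1) * integral {0..s} (\<lambda>u. sin_eps eps u ^ (n - 1)))"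

text \<open>
  The radius and the meridian of the sphere of mean curvature \<open>H\<close> (nonnormalized), for
  \<open>H > C_eps n eps\<close>.  At \<open>s = radius n eps H\<close> the integral defining the meridian is improper; the
  Henstock-Kurzweil integral covers this case, and the value of the integrand at the single
  singular endpoint is irrelevant.
\<close>

definition radius :: "nat \<Rightarrow> int \<Rightarrow> real \<Rightarrow> real" where
  "radius n eps H = (THE s. 0 < s \<and> ereal s < R_eps eps \<and> phi_eps n eps s = 1 / H)"

definition meridian :: "nat \<Rightarrow> int \<Rightarrow> real \<Rightarrow> real \<Rightarrow> real" where
  "meridian n eps H s =
     integral {0..s} (\<lambda>u. H * phi_eps n eps u / sqrt (1 - H\<^sup>2 * (phi_eps n eps u)\<^sup>2))"

definition sym_height :: "nat \<Rightarrow> int \<Rightarrow> real \<Rightarrow> real" where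
  "sym_height n eps H = meridian n eps H (radius n eps H)"

definition lower_hemisphere ::
    "int \<Rightarrow> (real ^ 'n::finite) \<times> real \<Rightarrow> real \<Rightarrow> (((real ^ 'n) \<times> real) \<times> real) set" where
  "lower_hemisphere eps p H =
     {(x, meridian CARD('n) eps H (geo_dist eps p x)) | x.
        x \<in> geo_ball eps p (radius CARD('n) eps H)}"

definition reflect_height :: "real \<Rightarrow> 'a \<times> real \<Rightarrow> 'a \<times> real" where
  "reflect_height h q = (fst q, 2 * h - snd q)"

definition lower_sheet ::
    "int \<Rightarrow> (real ^ 'n::finite) \<times> real \<Rightarrow> real \<Rightarrow> (((real ^ 'n) \<times> real) \<times> real) set" where
  "lower_sheet eps p H = closure (lower_hemisphere eps p H)"

definition upper_sheet ::
    "int \<Rightarrow> (real ^ 'n::finite) \<times> real \<Rightarrow> real \<Rightarrow> (((real ^ 'n) \<times> real) \<times> real) set" where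
  "upper_sheet eps p H = reflect_height (sym_height CARD('n) eps H) ` lower_sheet eps p H"

definition cmc_sphere ::
    "int \<Rightarrow> (real ^ 'n::finite) \<times> real \<Rightarrow> real \<Rightarrow> (((real ^ 'n) \<times> real) \<times> real) set" where
  "cmc_sphere eps p H = lower_sheet eps p H \<union> upper_sheet eps p H"

text \<open>
  The closed region of a space \<open>M\<close> enclosed by \<open>S \<subseteq> M\<close>: \<open>S\<close> together with the bounded components
  of \<open>M - S\<close> (the library's \<open>inside\<close> takes complements in the whole type instead).
\<close>

definition enclosed_region :: "'a::metric_space set \<Rightarrow> 'a set \<Rightarrow> 'a set" where
  "enclosed_region M S = S \<union> {q \<in> M - S. bounded (connected_component_set (M - S) q)}"

definition Omega ::
    "int \<Rightarrow> (real ^ 'n::finite) \<times> real \<Rightarrow> real \<Rightarrow> (((real ^ 'n) \<times> real) \<times> real) set" where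
  "Omega eps p H = enclosed_region (space_form eps \<times> UNIV) (cmc_sphere eps p H)"

definition nested :: "int \<Rightarrow> (real ^ 'n::finite) \<times> real \<Rightarrow> real \<Rightarrow> bool" where
  "nested eps p C \<longleftrightarrow> (\<forall>H H'. H > H' \<and> H' > C \<longrightarrow> Omega eps p H \<subseteq> Omega eps p H')"

text \<open>
  Uniform convergence of a family of sets to a set, that is, convergence in Hausdorff distance.
  For graphs of functions over subsets of a space form, with limit a horizontal slice, this says
  that the functions tend to the height of the slice uniformly over their domains and that the
  domains exhaust the space form uniformly.  On the sphere, chordal and geodesic distance are
  uniformly equivalent, so that the ambient \<open>dist\<close> can be used.
\<close>

definition converges_uniformly ::
    "('b \<Rightarrow> 'a::metric_space set) \<Rightarrow> 'a set \<Rightarrow> 'b filter \<Rightarrow> bool" where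
  "converges_uniformly S T F \<longleftrightarrow>
     (\<forall>e>0. \<forall>\<^sub>F H in F. (\<forall>a\<in>S H. \<exists>b\<in>T. dist a b < e) \<and> (\<forall>b\<in>T. \<exists>a\<in>S H. dist a b < e))"

end

theory Submission
  imports Defs
begin

text \<open>
  All the spheres \<open>\<Sigma>\<^sub>H\<close> touch at the same lowest point \<open>o\<close>, and the slope
  \<open>H \<phi> / sqrt (1 - H\<^sup>2 \<phi>\<^sup>2)\<close> of the meridian increases with \<open>H\<close>.  Hence for \<open>H > K\<close> the sphere
  \<open>\<Sigma>\<^sub>H\<close> has the smaller radius and its lower hemisphere lies above that of \<open>\<Sigma>\<^sub>K\<close>.  The enclosed
  region consists of the points over the ball whose distance from the plane of symmetry, at height \<open>h(H)\<close>, is at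
  most \<open>h(H)\<close> minus the height of the meridian.  So the only obstruction to \<open>\<Omega>\<^sub>H \<subseteq> \<Omega>\<^sub>K\<close> sits on
  the axis, at the highest point, and the inclusion is equivalent to \<open>h(H) \<le> h(K)\<close>
  (\<open>Omega_subset_iff\<close>).  Everything reduces to the monotonicity of the single real function \<open>h\<close>.

  The substitution \<open>H \<phi>(s) = sin \<theta>\<close> turns the improper integral for \<open>h\<close> into
  \<open>h(H) = \<integral> f(sin \<theta> / H) d\<theta>\<close> over \<open>[0, \<pi>/2]\<close>, where \<open>f\<close> expresses \<open>F = \<phi>/\<phi>'\<close> as a function of the
  value of \<open>\<phi>\<close> (\<open>sym_height_eq\<close>).  Consequently \<open>h\<close> is nonincreasing in \<open>H\<close> as long as the radii stay
  in a range where \<open>F\<close> is increasing.  The sign of \<open>F'\<close> is that of an explicit function \<open>Q\<close>, and two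
  successive comparisons with vanishing value at \<open>0\<close> (\<open>I_upper_bound\<close>, \<open>Q_pos\<close>) show \<open>Q > 0\<close>
  everywhere in the hyperbolic case, which gives part A, and for \<open>s < \<pi>/4\<close> in the spherical case,
  which covers all large \<open>H\<close>.

  When \<open>H\<close> tends to \<open>0\<close> on the sphere, \<open>z = 1/H\<close> tends to infinity, and so does the argument of
  \<open>f\<close> away from \<open>\<theta> = 0\<close>.  There \<open>f\<close> tends to \<open>0\<close>, so \<open>h\<close> does; but it decays so slowly that even
  \<open>f(z) - c/z\<close> is nonincreasing for some \<open>c > 0\<close> (\<open>f_decay\<close>).  Since \<open>\<integral> d\<theta> / sin \<theta>\<close> diverges
  logarithmically at \<open>0\<close>, the decrease of \<open>f\<close> at large arguments outweighs the bounded contribution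
  of its initial growth (\<open>average_decreasing_step\<close>): \<open>h\<close> strictly increases with \<open>H\<close> near \<open>0\<close>.  The
  threshold \<open>C\<^sub>m\<^sub>i\<^sub>n\<close> is then the infimum of the \<open>C \<ge> 0\<close> beyond which \<open>h\<close> is nonincreasing; it is positive
  because \<open>h\<close> increases near \<open>0\<close>, and finite because \<open>h\<close> is nonincreasing for large \<open>H\<close>.  Finally
  the radii tend to \<open>\<pi>\<close> and the heights to \<open>0\<close>, so both hemispheres converge to the slice.
\<close>

section \<open>Monotonicity from derivatives in the open interval\<close>

text \<open>
  Derivatives are only required inside the interval, because the functions of interest are
  differentiable at positive arguments but merely continuous up to \<open>0\<close>.
\<close>

lemma increasing_from_zero:
  fixes g :: "real \<Rightarrow> real"
  assumes "0 < s" "continuous_on {0..s} g"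
    and "\<And>x. 0 < x \<Longrightarrow> x < s \<Longrightarrow> (g has_real_derivative g' x) (at x)"
    and "\<And>x. 0 < x \<Longrightarrow> x < s \<Longrightarrow> g' x > 0"
  shows "g 0 < g s"
  using assms by (intro DERIV_pos_imp_increasing_open[of 0 s g]) auto

lemma nondecreasing_between:
  fixes g :: "real \<Rightarrow> real"
  assumes "a \<le> b" "continuous_on {a..b} g"
    and d: "\<And>x. a < x \<Longrightarrow> x < b \<Longrightarrow> (g has_real_derivative g' x) (at x)"
    and nn: "\<And>x. a < x \<Longrightarrow> x < b \<Longrightarrow> g' x \<ge> 0"
  shows "g a \<le> g b"
proof (cases "a = b")
  case False
  then have "a < b" using assms by simp
  have "g differentiable (at x)" if "a < x" "x < b" for x
    unfolding real_differentiable_def using d[OF that] by (rule exI)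
  with \<open>a < b\<close> assms(2)
  have "\<exists>l z. a < z \<and> z < b \<and> (g has_real_derivative l) (at z) \<and> g b - g a = (b - a) * l"
    by (rule MVT)
  then obtain l z where z: "a < z" "z < b" "(g has_real_derivative l) (at z)"
      "g b - g a = (b - a) * l"
    by auto
  then have "l \<ge> 0" using DERIV_unique[OF z(3) d[OF z(1,2)]] nn by simp
  then have "(b - a) * l \<ge> 0" using \<open>a < b\<close> by simp
  then show ?thesis using z(4) by simp
qed simp

section \<open>The calculus of the profile function\<close>

text \<open>
  Both geometries are treated at once.  The calculus below only uses that \<open>sn' = cs\<close>,
  \<open>cs' = - e sn\<close> and \<open>cs\<^sup>2 + e sn\<^sup>2 = 1\<close>, so the same formulas serve for the circular functions
  (\<open>e = 1\<close>) and the hyperbolic ones (\<open>e = -1\<close>).  The dimension of the space form is \<open>m + 1\<close>.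
\<close>

locale rotational_profile =
  fixes eps :: int and m :: nat
  assumes eps: "eps = 1 \<or> eps = -1" and m: "m \<ge> 1"
begin

abbreviation e :: real where "e \<equiv> of_int eps"
abbreviation sn :: "real \<Rightarrow> real" where "sn \<equiv> sin_eps eps"
abbreviation phi :: "real \<Rightarrow> real" where "phi \<equiv> phi_eps (Suc m) eps"

definition cs :: "real \<Rightarrow> real" where
  "cs = (if eps = 1 then cos else cosh)"

definition I :: "real \<Rightarrow> real" where
  "I s = integral {0..s} (\<lambda>u. sn u ^ m)"

text \<open>
  Since \<open>\<phi> = I / sn\<^sup>m\<close>, the derivative of \<open>\<phi>\<close> is \<open>J / sn\<^sup>m\<^sup>+\<^sup>1\<close>.  With \<open>F = \<phi> / \<phi>'\<close> the terms of
  \<open>F'\<close> combine to \<open>Q / J\<^sup>2\<close>, so \<open>J\<close> and \<open>Q\<close> carry the signs of \<open>\<phi>'\<close> and \<open>F'\<close>.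
\<close>

definition J :: "real \<Rightarrow> real" where
  "J s = sn s ^ (m + 1) - m * cs s * I s"

definition Q :: "real \<Rightarrow> real" where
  "Q s = sn s ^ (2 * m + 2) - m * sn s ^ (m + 1) * cs s * I s - m * (I s)\<^sup>2"

definition F :: "real \<Rightarrow> real" where
  "F s = I s * sn s / J s"

definition radii :: "real set" where
  "radii = {s. 0 < s \<and> ereal s < R_eps eps}"

text \<open>
  Radii up to which \<open>cs\<^sup>2 \<ge> 1/2\<close>: no restriction in hyperbolic space, where \<open>cosh \<ge> 1\<close>.
\<close>

definition inner_range :: "real set" where
  "inner_range = {s. 0 < s \<and> (eps = 1 \<longrightarrow> s < pi / 4)}"

lemma radii_iff: "s \<in> radii \<longleftrightarrow> 0 < s \<and> (eps = 1 \<longrightarrow> s < pi)"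
  using eps by (auto simp: radii_def R_eps_def)

lemma radii_down: "s \<in> radii \<Longrightarrow> 0 < t \<Longrightarrow> t \<le> s \<Longrightarrow> t \<in> radii"
  by (auto simp: radii_iff)

lemma inner_range_down: "s \<in> inner_range \<Longrightarrow> 0 < t \<Longrightarrow> t \<le> s \<Longrightarrow> t \<in> inner_range"
  by (auto simp: inner_range_def)

lemma inner_range_radii: "s \<in> inner_range \<Longrightarrow> s \<in> radii"
  using pi_gt_zero by (auto simp: radii_iff inner_range_def)

lemma sn_0 [simp]: "sn 0 = 0"
  by (simp add: sin_eps_def)

lemma cs_0 [simp]: "cs 0 = 1"
  by (simp add: cs_def)

lemma e_sq: "e * e = 1"
  using eps by auto

lemma DERIV_sn [derivative_intros]:
  "(f has_field_derivative f') (at x within A) \<Longrightarrow>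
    ((\<lambda>x. sn (f x)) has_field_derivative cs (f x) * f') (at x within A)"
  unfolding sin_eps_def cs_def by (auto intro!: derivative_eq_intros)

lemma DERIV_cs [derivative_intros]:
  "(f has_field_derivative f') (at x within A) \<Longrightarrow>
    ((\<lambda>x. cs (f x)) has_field_derivative - e * sn (f x) * f') (at x within A)"
  unfolding sin_eps_def cs_def using eps by (auto intro!: derivative_eq_intros)

lemma pythagoras: "(cs s)\<^sup>2 + e * (sn s)\<^sup>2 = 1"
  using eps by (auto simp: cs_def sin_eps_def cosh_square_eq)

lemma sn_pos: "s \<in> radii \<Longrightarrow> sn s > 0"
  using eps by (auto simp: sin_eps_def radii_iff sin_gt_zero)

lemma cs_sq_inner:
  assumes "s \<in> inner_range"
  shows "cs s > 0" "(cs s)\<^sup>2 \<ge> 1 / 2"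
proof -
  have "cs s > 0 \<and> (cs s)\<^sup>2 \<ge> 1 / 2"
  proof (cases "eps = 1")
    case True
    with assms have s: "0 < s" "s < pi / 4" unfolding inner_range_def by auto
    have "cos (pi / 4) \<le> cos s" using s by (subst cos_mono_le_eq) auto
    then have 1: "sqrt 2 / 2 \<le> cos s" by (simp add: cos_45)
    have "(sqrt 2 / 2)\<^sup>2 \<le> (cos s)\<^sup>2"
      by (rule power_mono[OF 1]) simp
    moreover have "cos s > 0" using 1 by (smt (verit) half_gt_zero real_sqrt_gt_zero)
    ultimately show ?thesis unfolding cs_def using True by (simp add: power_divide)
  next
    case False
    have "1 \<le> (cosh s)\<^sup>2" by (simp add: cosh_real_ge_1)
    then show ?thesis unfolding cs_def using False by simp
  qed
  then show "cs s > 0" "(cs s)\<^sup>2 \<ge> 1 / 2" by auto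
qed

lemma continuous_on_sn [continuous_intros]:
  fixes f :: "real \<Rightarrow> real"
  shows "continuous_on A f \<Longrightarrow> continuous_on A (\<lambda>x. sn (f x))"
  unfolding sin_eps_def by (auto intro!: continuous_intros)

lemma continuous_on_cs [continuous_intros]:
  fixes f :: "real \<Rightarrow> real"
  shows "continuous_on A f \<Longrightarrow> continuous_on A (\<lambda>x. cs (f x))"
  unfolding cs_def by (auto intro!: continuous_intros)

lemma I_0 [simp]: "I 0 = 0"
  by (simp add: I_def)

lemma continuous_on_I: "continuous_on {0..b} I"
  unfolding I_def
  by (intro indefinite_integral_continuous_1 integrable_continuous_real continuous_intros)

lemma DERIV_I:
  assumes "0 < s"
  shows "(I has_real_derivative sn s ^ m) (at s)"
proof -
  have "((\<lambda>x. integral {0..x} (\<lambda>u. sn u ^ m)) has_real_derivative sn s ^ m) (at s within {0..s+1})"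
    by (rule integral_has_real_derivative) (use assms in \<open>auto intro!: continuous_intros\<close>)
  moreover have "at s within {0..s+1} = at s"
    using assms by (intro at_within_interior) auto
  ultimately show ?thesis
    by (simp add: I_def[abs_def])
qed

lemma I_pos:
  assumes s: "s \<in> radii"
  shows "I s > 0"
proof -
  have "I 0 < I s"
  proof (rule increasing_from_zero[where g' = "\<lambda>x. sn x ^ m"])
    fix x assume "0 < x" "x < s"
    then have "x \<in> radii" using s radii_down by auto
    then show "0 < sn x ^ m" using sn_pos by simp
  qed (use s in \<open>auto simp: radii_iff continuous_on_I DERIV_I\<close>)
  then show ?thesis by simp
qed

lemma DERIV_sn_power:
  "((\<lambda>x. sn x ^ (m + 1)) has_real_derivative (m + 1) * sn x ^ m * cs x) (at x)"
  by (rule DERIV_cong[OF DERIV_power[OF DERIV_sn[OF DERIV_ident]]]) simp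

section \<open>The signs of the derivatives of \<open>\<phi>\<close> and \<open>F\<close>\<close>

text \<open>
  The basic estimate: it makes \<open>Q\<close> increase and \<open>J\<close> positive.  Put \<open>D = (m + 2) cs\<^sup>2 + 1\<close>.  The
  function \<open>(m + 2) sn\<^sup>m\<^sup>+\<^sup>1 cs / D - m I\<close> vanishes at \<open>0\<close>, and the powers \<open>cs\<^sup>4\<close> cancel in its
  derivative, which is \<open>sn\<^sup>m (4 (m + 2) cs\<^sup>2 - 2 (m + 1)) / D\<^sup>2\<close> and hence positive when \<open>cs\<^sup>2 \<ge> 1/2\<close>.
\<close>

lemma I_upper_bound:
  assumes s: "s \<in> inner_range"
  shows "m * I s * ((m + 2) * (cs s)\<^sup>2 + 1) < (m + 2) * sn s ^ (m + 1) * cs s"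
proof -
  let ?D = "\<lambda>s. (real m + 2) * (cs s)\<^sup>2 + 1"
  let ?g = "\<lambda>s. (m + 2) * (sn s ^ (m + 1) * cs s) / ?D s - m * I s"
  let ?g' = "\<lambda>s. sn s ^ m * (4 * (m + 2) * (cs s)\<^sup>2 - 2 * (m + 1)) / (?D s)\<^sup>2"
  have D: "?D x > 0" for x
    by (simp add: add_nonneg_pos)
  have s0: "0 < s" using s by (simp add: inner_range_def)
  have "?g 0 < ?g s"
  proof (rule increasing_from_zero[OF s0, where g' = ?g'])
    show "continuous_on {0..s} ?g"
      using D by (auto intro!: continuous_intros continuous_on_I simp: less_imp_neq[OF D, symmetric])
  next
    fix x assume x: "0 < x" "x < s"
    let ?S = "sn x" and ?c = "cs x"
    have es: "e * ?S\<^sup>2 = 1 - ?c\<^sup>2" using pythagoras[of x] by simp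
    have es2: "e * (?S * ?S) = 1 - ?c\<^sup>2" using es by (simp add: power2_eq_square)
    have key: "(((m + 2) * ((m + 1) * ?S ^ m * ?c * ?c + ?S ^ (m + 1) * (- e * ?S))) * ?D x
        - (m + 2) * (?S ^ (m + 1) * ?c) * ((m + 2) * (2 * ?c * (- e * ?S)))) - m * ?S ^ m * (?D x)\<^sup>2
        = ?S ^ m * (4 * (m + 2) * ?c\<^sup>2 - 2 * (m + 1))"
    proof -
      have "(((m + 2) * ((m + 1) * ?S ^ m * ?c * ?c + ?S ^ (m + 1) * (- e * ?S))) * ?D x
        - (m + 2) * (?S ^ (m + 1) * ?c) * ((m + 2) * (2 * ?c * (- e * ?S)))) - m * ?S ^ m * (?D x)\<^sup>2
        = ?S ^ m * ((m + 2) * ((m + 1) * ?c\<^sup>2 - e * (?S * ?S)) * ?D x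
           + (m + 2) * (m + 2) * 2 * ?c\<^sup>2 * (e * (?S * ?S)) - m * (?D x)\<^sup>2)"
        by (simp add: algebra_simps power2_eq_square)
      also have "\<dots> = ?S ^ m * (4 * (m + 2) * ?c\<^sup>2 - 2 * (m + 1))"
        unfolding es2 by (simp add: algebra_simps power2_eq_square)
      finally show ?thesis .
    qed
    have dN: "((\<lambda>x. (m + 2) * (sn x ^ (m + 1) * cs x)) has_real_derivative
        (m + 2) * ((m + 1) * ?S ^ m * ?c * ?c + ?S ^ (m + 1) * (- e * ?S))) (at x)"
      by (rule DERIV_cong[OF DERIV_cmult[OF
            DERIV_mult'[OF DERIV_sn_power DERIV_cs[OF DERIV_ident]]]]) simp
    have dD: "(?D has_real_derivative (m + 2) * (2 * ?c * (- e * ?S))) (at x)"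
      by (auto intro!: derivative_eq_intros simp: power2_eq_square)
    have "(?g has_real_derivative
       (((m + 2) * ((m + 1) * ?S ^ m * ?c * ?c + ?S ^ (m + 1) * (- e * ?S))) * ?D x
        - (m + 2) * (?S ^ (m + 1) * ?c) * ((m + 2) * (2 * ?c * (- e * ?S)))) / (?D x)\<^sup>2 - m * ?S ^ m) (at x)"
      using D[of x]
      by (intro DERIV_cong[OF DERIV_diff[OF DERIV_divide[OF dN dD] DERIV_cmult[OF DERIV_I[OF x(1)]]]])
         (simp_all add: power2_eq_square)
    also have "(((m + 2) * ((m + 1) * ?S ^ m * ?c * ?c + ?S ^ (m + 1) * (- e * ?S))) * ?D x
        - (m + 2) * (?S ^ (m + 1) * ?c) * ((m + 2) * (2 * ?c * (- e * ?S)))) / (?D x)\<^sup>2 - m * ?S ^ m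
        = ?g' x"
      unfolding key[symmetric] using D[of x] by (simp add: diff_divide_distrib)
    finally show "(?g has_real_derivative ?g' x) (at x)" .
    have xi: "x \<in> inner_range" using s x inner_range_down by auto
    have "4 * (real m + 2) * ?c\<^sup>2 \<ge> 4 * (real m + 2) * (1/2)"
      by (rule mult_left_mono[OF cs_sq_inner(2)[OF xi]]) simp
    then have "4 * (m + 2) * ?c\<^sup>2 - 2 * (m + 1) > 0" by (simp add: algebra_simps)
    then show "?g' x > 0"
      using D[of x] sn_pos[OF inner_range_radii[OF xi]] by (intro divide_pos_pos mult_pos_pos) auto
  qed
  then have "m * I s < (m + 2) * (sn s ^ (m + 1) * cs s) / ?D s" by simp
  then show ?thesis
    using D[of s] by (simp add: pos_less_divide_eq mult.assoc add.commute)
qed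

text \<open>
  \<open>Q\<close> vanishes at \<open>0\<close>, and \<open>Q'\<close> is \<open>sn\<^sup>m\<close> times the gap between the two sides of \<open>I_upper_bound\<close>.
\<close>

lemma Q_pos:
  assumes s: "s \<in> inner_range"
  shows "Q s > 0"
proof -
  let ?g' = "\<lambda>x. sn x ^ m * ((m + 2) * sn x ^ (m + 1) * cs x - m * I x * ((m + 2) * (cs x)\<^sup>2 + 1))"
  have Q_eq: "Q = (\<lambda>x. sn x ^ (m + 1) * sn x ^ (m + 1) - m * (sn x ^ (m + 1) * cs x) * I x - m * (I x * I x))"
    by (rule ext) (simp add: Q_def power2_eq_square power_add[symmetric] mult_2 mult.assoc)
  have "Q 0 < Q s"
  proof (rule increasing_from_zero[where g' = ?g'])
    show "0 < s" using s by (simp add: inner_range_def)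
    show "continuous_on {0..s} Q"
      unfolding Q_eq by (intro continuous_intros continuous_on_I)
  next
    fix x assume x: "0 < x" "x < s"
    let ?S = "sn x" and ?c = "cs x"
    have es: "e * (?S * ?S) = 1 - ?c\<^sup>2" using pythagoras[of x] by (simp add: power2_eq_square)
    have dN: "((\<lambda>x. m * (sn x ^ (m + 1) * cs x)) has_real_derivative
        m * ((m + 1) * ?S ^ m * ?c * ?c + ?S ^ (m + 1) * (- e * ?S))) (at x)"
      by (rule DERIV_cong[OF DERIV_cmult[OF
            DERIV_mult'[OF DERIV_sn_power DERIV_cs[OF DERIV_ident]]]]) simp
    have "m * ((m + 1) * ?S ^ m * ?c * ?c + ?S ^ (m + 1) * (- e * ?S))
        = m * ?S ^ m * ((m + 1) * ?c\<^sup>2 - e * (?S * ?S))"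
      by (simp add: algebra_simps power2_eq_square)
    also have "\<dots> = m * ?S ^ m * ((m + 2) * ?c\<^sup>2 - 1)"
      unfolding es by (simp add: algebra_simps)
    finally have N': "m * ((m + 1) * ?S ^ m * ?c * ?c + ?S ^ (m + 1) * (- e * ?S))
        = m * ?S ^ m * ((m + 2) * ?c\<^sup>2 - 1)" .
    note dI = DERIV_I[OF x(1)]
    show "(Q has_real_derivative ?g' x) (at x)"
      unfolding Q_eq
      by (rule DERIV_cong[OF DERIV_diff[OF DERIV_diff[OF
              DERIV_mult'[OF DERIV_sn_power DERIV_sn_power]
              DERIV_mult'[OF dN[unfolded N'] dI]] DERIV_cmult[OF DERIV_mult'[OF dI dI]]]])
         (simp add: algebra_simps power2_eq_square)
    have xi: "x \<in> inner_range" using s x inner_range_down by auto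
    show "?g' x > 0"
      using I_upper_bound[OF xi] sn_pos[OF inner_range_radii[OF xi]]
      by (intro mult_pos_pos) auto
  qed
  then show ?thesis by (simp add: Q_def)
qed

text \<open>
  This is \<open>I_upper_bound\<close> multiplied by \<open>cs > 0\<close>.
\<close>

lemma J_lower_bound_inner:
  assumes s: "s \<in> inner_range"
  shows "sn s ^ (m + 1) < J s * ((m + 2) * (cs s)\<^sup>2 + 1)"
proof -
  have "cs s * (m * I s * ((m + 2) * (cs s)\<^sup>2 + 1)) < cs s * ((m + 2) * sn s ^ (m + 1) * cs s)"
    by (rule mult_strict_left_mono[OF I_upper_bound[OF s] cs_sq_inner(1)[OF s]])
  then show ?thesis by (simp add: J_def algebra_simps power2_eq_square)
qed

text \<open>
  It says that \<open>\<phi>' > 1/(m + 1)\<close> on all of \<open>(0, \<pi>)\<close>, also beyond the range of \<open>I_upper_bound\<close>.  The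
  reason is that \<open>sin\<^sup>m\<^sup>+\<^sup>1 - (m + 1) I cos\<close> has the derivative \<open>(m + 1) I sin > 0\<close>.
\<close>

lemma J_lower_bound_sphere:
  assumes "eps = 1" "s \<in> radii"
  shows "sn s ^ (m + 1) < (m + 1) * J s"
proof -
  let ?g = "\<lambda>s. sn s ^ (m + 1) - (m + 1) * (cs s * I s)"
  let ?g' = "\<lambda>s. (m + 1) * (sn s * I s)"
  have "?g 0 < ?g s"
  proof (rule increasing_from_zero[where g' = ?g'])
    show "0 < s" using assms(2) by (simp add: radii_iff)
    show "continuous_on {0..s} ?g"
      by (intro continuous_intros continuous_on_I)
  next
    fix x assume x: "0 < x" "x < s"
    show "(?g has_real_derivative ?g' x) (at x)"
      by (rule DERIV_cong[OF DERIV_diff[OF DERIV_sn_power DERIV_cmult[OF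
           DERIV_mult'[OF DERIV_cs[OF DERIV_ident] DERIV_I[OF x(1)]]]]])
         (simp add: algebra_simps assms)
    have "x \<in> radii" using assms x radii_down by auto
    then show "?g' x > 0" using sn_pos I_pos by (auto intro!: mult_pos_pos)
  qed
  then have g: "0 < ?g s" by simp
  have "(m + 1) * J s - sn s ^ (m + 1) = m * ?g s"
    by (simp add: J_def algebra_simps)
  also have "\<dots> > 0" using m by (intro mult_pos_pos g) auto
  finally show ?thesis by simp
qed

lemma J_pos:
  assumes s: "s \<in> radii"
  shows "J s > 0"
proof (cases "eps = 1")
  case True
  have "0 < (m + 1) * J s"
    using J_lower_bound_sphere[OF True s] sn_pos[OF s] by (smt (verit) zero_less_power)
  then show ?thesis by (simp add: zero_less_mult_iff)
next
  case False
  then have "s \<in> inner_range" using s by (simp add: radii_iff inner_range_def)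
  then have "0 < J s * ((m + 2) * (cs s)\<^sup>2 + 1)"
    using J_lower_bound_inner sn_pos[OF s] by (smt (verit) zero_less_power)
  moreover have "0 < (m + 2) * (cs s)\<^sup>2 + 1" by (simp add: add_nonneg_pos)
  ultimately show ?thesis by (simp add: zero_less_mult_iff)
qed

lemma phi_0 [simp]: "phi 0 = 0"
  by (simp add: phi_eps_def)

lemma phi_eq: "s \<noteq> 0 \<Longrightarrow> phi s = I s / sn s ^ m"
  by (simp add: phi_eps_def I_def)

lemma phi_pos: "s \<in> radii \<Longrightarrow> phi s > 0"
  by (subst phi_eq) (auto simp: radii_iff[of s] intro!: divide_pos_pos I_pos sn_pos zero_less_power)

lemma F_0 [simp]: "F 0 = 0"
  by (simp add: F_def)

lemma F_pos: "s \<in> radii \<Longrightarrow> F s > 0"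
  by (simp add: F_def I_pos sn_pos J_pos)

lemma DERIV_J:
  assumes "0 < s"
  shows "(J has_real_derivative sn s ^ m * cs s + m * e * sn s * I s) (at s)"
proof -
  have J_eq: "J = (\<lambda>s. sn s ^ (m + 1) - m * (cs s * I s))"
    by (rule ext) (simp add: J_def)
  show ?thesis
    unfolding J_eq
    by (rule DERIV_cong[OF DERIV_diff[OF DERIV_sn_power DERIV_cmult[OF
         DERIV_mult'[OF DERIV_cs[OF DERIV_ident] DERIV_I[OF assms]]]]])
       (simp add: algebra_simps)
qed

lemma DERIV_phi:
  assumes s: "s \<in> radii"
  shows "(phi has_real_derivative J s / sn s ^ (m + 1)) (at s)"
proof -
  have s0: "0 < s" and sn0: "sn s > 0" using s sn_pos by (auto simp: radii_iff)
  have d: "((\<lambda>x. sn x ^ m) has_real_derivative m * (cs s * sn s ^ (m - 1))) (at s)"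
    by (rule DERIV_cong[OF DERIV_power[OF DERIV_sn[OF DERIV_ident]]]) simp
  have "((\<lambda>s. I s / sn s ^ m) has_real_derivative J s / sn s ^ (m + 1)) (at s)"
  proof (rule DERIV_cong[OF DERIV_divide[OF DERIV_I[OF s0] d]])
    show "sn s ^ m \<noteq> 0" using sn0 by simp
    have "sn s ^ m = sn s * sn s ^ (m - 1)" using m by (cases m) auto
    then show "(sn s ^ m * sn s ^ m - I s * (m * (cs s * sn s ^ (m - 1)))) / (sn s ^ m * sn s ^ m)
        = J s / sn s ^ (m + 1)"
      using sn0 by (simp add: J_def field_simps)
  qed
  then show ?thesis
    by (rule has_field_derivative_transform_within_open[where S = "{0<..}"])
       (use s0 in \<open>auto simp: phi_eq\<close>)
qed

lemma DERIV_F: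
  assumes s: "s \<in> radii"
  shows "(F has_real_derivative Q s / (J s)\<^sup>2) (at s)"
proof -
  have s0: "0 < s" using s by (auto simp: radii_iff)
  have es: "e * (sn s * sn s) = 1 - cs s * cs s" using pythagoras[of s] by (simp add: power2_eq_square)
  show ?thesis
    unfolding F_def[abs_def]
  proof (rule DERIV_cong[OF DERIV_divide[OF
        DERIV_mult'[OF DERIV_I[OF s0] DERIV_sn[OF DERIV_ident]] DERIV_J[OF s0]]])
    show "J s \<noteq> 0" using J_pos[OF s] by simp
    have "(I s * (cs s * 1) + sn s ^ m * sn s) * J s - I s * sn s * (sn s ^ m * cs s + m * e * sn s * I s)
       = (I s * cs s + sn s ^ (m + 1)) * J s - I s * sn s ^ (m + 1) * cs s - m * (I s * I s) * (e * (sn s * sn s))"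
      by (simp add: algebra_simps)
    also have "\<dots> = Q s"
      unfolding es by (simp add: J_def Q_def algebra_simps power2_eq_square power_add[symmetric] mult_2 mult_2_right)
    finally show "((I s * (cs s * 1) + sn s ^ m * sn s) * J s
          - I s * sn s * (sn s ^ m * cs s + m * e * sn s * I s)) / (J s * J s) = Q s / (J s)\<^sup>2"
      by (simp add: power2_eq_square)
  qed
qed

lemma F_eq: "s \<in> radii \<Longrightarrow> F s = phi s * (sn s ^ (m + 1) / J s)"
  using sn_pos[of s] by (subst phi_eq) (auto simp: F_def radii_iff)

text \<open>
  At \<open>s = 0\<close> the quotient \<open>F\<close> reads \<open>0/0\<close>.  This bound, the product of \<open>I_upper_bound\<close> and
  \<open>J_lower_bound_inner\<close>, shows that \<open>F\<close> is nevertheless continuous there with value \<open>0\<close>.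
\<close>

lemma F_bound_inner:
  assumes s: "s \<in> inner_range"
  shows "F s \<le> 3 * (sn s * cs s)"
proof -
  let ?D = "(real m + 2) * (cs s)\<^sup>2 + 1"
  note r = inner_range_radii[OF s]
  have D: "?D > 0" by (simp add: add_nonneg_pos)
  have c: "cs s > 0" using cs_sq_inner[OF s] by simp
  have "(m * I s * ?D) * (sn s * sn s ^ (m + 1)) \<le> ((m + 2) * sn s ^ (m + 1) * cs s) * (sn s * (J s * ?D))"
  proof (rule mult_mono)
    show "m * I s * ?D \<le> (m + 2) * sn s ^ (m + 1) * cs s"
      using I_upper_bound[OF s] by (simp add: add.commute)
    show "sn s * sn s ^ (m + 1) \<le> sn s * (J s * ?D)"
      using J_lower_bound_inner[OF s] sn_pos[OF r] by (intro mult_left_mono) (auto simp: add.commute)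
  qed (use sn_pos[OF r] c in \<open>auto intro!: mult_nonneg_nonneg\<close>)
  then have "(m * I s * sn s) * (?D * sn s ^ (m + 1)) \<le> ((m + 2) * cs s * sn s * J s) * (?D * sn s ^ (m + 1))"
    by (simp only: mult_ac)
  then have 1: "m * (I s * sn s) \<le> (m + 2) * (sn s * cs s * J s)"
    using D sn_pos[OF r] by (subst (asm) mult_le_cancel_right_pos) (auto simp: mult_ac)
  have "(real m + 2) * (sn s * cs s * J s) \<le> (3 * m) * (sn s * cs s * J s)"
    using m sn_pos[OF r] c J_pos[OF r] by (intro mult_right_mono) auto
  also have "\<dots> = m * (3 * (sn s * cs s) * J s)" by simp
  finally have "m * (I s * sn s) \<le> m * (3 * (sn s * cs s) * J s)"
    using 1 by (simp only: of_nat_add of_nat_numeral)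
  then have "I s * sn s \<le> 3 * (sn s * cs s) * J s" using m by simp
  then show ?thesis
    using J_pos[OF r] by (simp add: F_def pos_divide_le_eq)
qed

lemma phi_le_F_inner:
  assumes s: "s \<in> inner_range"
  shows "phi s \<le> F s"
proof -
  note r = inner_range_radii[OF s]
  have "J s \<le> sn s ^ (m + 1)"
    using cs_sq_inner(1)[OF s] I_pos[OF r] by (simp add: J_def)
  then have "1 \<le> sn s ^ (m + 1) / J s" using J_pos[OF r] by (simp add: pos_le_divide_eq)
  then have "phi s * 1 \<le> phi s * (sn s ^ (m + 1) / J s)"
    using phi_pos[OF r] by (intro mult_left_mono) auto
  then show ?thesis by (simp add: F_eq r)
qed

section \<open>Behaviour at zero and monotonicity\<close>

lemma tendsto_zero_at_right_if_below_F:
  assumes "\<And>s. s \<in> inner_range \<Longrightarrow> 0 \<le> g s \<and> g s \<le> F s"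
  shows "(g \<longlongrightarrow> 0) (at_right 0)"
proof (rule tendsto_sandwich)
  have ev: "\<forall>\<^sub>F s in at_right 0. s \<in> inner_range"
    unfolding eventually_at_right_field inner_range_def
    by (rule exI[of _ "pi/4"]) auto
  show "\<forall>\<^sub>F s in at_right 0. 0 \<le> g s"
    using ev by eventually_elim (use assms in auto)
  show "\<forall>\<^sub>F s in at_right 0. g s \<le> 3 * (sn s * cs s)"
    using ev by eventually_elim (use assms F_bound_inner order_trans in blast)
  have "continuous_on UNIV (\<lambda>s. 3 * (sn s * cs s))"
    by (intro continuous_intros)
  then have "((\<lambda>s. 3 * (sn s * cs s)) \<longlongrightarrow> 3 * (sn 0 * cs 0)) (at 0)"
    unfolding continuous_on_def by blast
  then show "((\<lambda>s. 3 * (sn s * cs s)) \<longlongrightarrow> 0) (at_right 0)"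
    by (simp add: filterlim_at_split)
qed simp

lemma continuous_on_from_zero:
  fixes g :: "real \<Rightarrow> real"
  assumes r: "r \<in> radii" and 0: "(g \<longlongrightarrow> g 0) (at_right 0)"
    and d: "\<And>s. s \<in> radii \<Longrightarrow> (g has_real_derivative g' s) (at s)"
  shows "continuous_on {0..r} g"
  unfolding continuous_on_eq_continuous_within
proof
  fix x assume x: "x \<in> {0..r}"
  show "continuous (at x within {0..r}) g"
  proof (cases "x = 0")
    case True
    have "at 0 within {0..r} = at_right 0"
      using r by (intro at_within_Icc_at_right) (simp add: radii_iff)
    then show ?thesis using 0 True by (simp add: continuous_within)
  next
    case False
    then have "x \<in> radii" using x r radii_down by auto
    then show ?thesis using d DERIV_isCont continuous_at_imp_continuous_at_within by blast
  qed
qed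

lemma continuous_on_F:
  assumes "r \<in> radii"
  shows "continuous_on {0..r} F"
proof (rule continuous_on_from_zero[OF assms _ DERIV_F])
  show "(F \<longlongrightarrow> F 0) (at_right 0)"
    using tendsto_zero_at_right_if_below_F[of F] F_pos inner_range_radii by force
qed

lemma continuous_on_phi:
  assumes "r \<in> radii"
  shows "continuous_on {0..r} phi"
proof (rule continuous_on_from_zero[OF assms _ DERIV_phi])
  show "(phi \<longlongrightarrow> phi 0) (at_right 0)"
    using tendsto_zero_at_right_if_below_F[of phi] phi_pos inner_range_radii phi_le_F_inner by force
qed

lemma phi_strict_mono:
  assumes "0 \<le> a" "a < b" "b \<in> radii"
  shows "phi a < phi b"
proof (rule DERIV_pos_imp_increasing_open[OF \<open>a < b\<close>])
  fix x assume "a < x" "x < b"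
  then have "x \<in> radii" using assms radii_down by auto
  then show "\<exists>y. (phi has_real_derivative y) (at x) \<and> 0 < y"
    using DERIV_phi J_pos sn_pos by (intro exI conjI) (auto intro!: divide_pos_pos)
next
  show "continuous_on {a..b} phi"
    by (rule continuous_on_subset[OF continuous_on_phi[OF assms(3)]]) (use assms in auto)
qed

lemma F_mono_inner:
  assumes "0 \<le> a" "a \<le> b" "b \<in> inner_range"
  shows "F a \<le> F b"
proof (rule nondecreasing_between[OF assms(2)])
  show "continuous_on {a..b} F"
    by (cases "b = 0", use assms in force)
       (rule continuous_on_subset[OF continuous_on_F[OF inner_range_radii[OF assms(3)]]],
        use assms in auto)
  fix x assume "a < x" "x < b"
  then have x: "x \<in> inner_range" using assms inner_range_down by auto
  show "(F has_real_derivative Q x / (J x)\<^sup>2) (at x)"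
    by (rule DERIV_F[OF inner_range_radii[OF x]])
  show "Q x / (J x)\<^sup>2 \<ge> 0"
    using Q_pos[OF x] by simp
qed

section \<open>Existence and monotonicity of the radius\<close>

text \<open>
  Past \<open>\<pi>/2\<close> the numerator \<open>I\<close> of \<open>\<phi>\<close> is at least \<open>k = I (\<pi>/2)\<close> while the denominator tends to \<open>0\<close>
  at \<open>\<pi>\<close>.  At the point where \<open>sin s = y\<close> this gives \<open>\<phi> s \<ge> k / y\<close>, and \<open>y\<close> is chosen so that
  \<open>k / y = k + \<bar>z\<bar>\<close>.
\<close>

lemma phi_unbounded_sphere:
  assumes "eps = 1"
  shows "\<exists>s\<in>radii. z \<le> phi s"
proof -
  have r: "pi / 2 \<in> radii" unfolding radii_iff by simp
  define k where "k = I (pi / 2)"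
  have k: "k > 0" using I_pos[OF r] by (simp add: k_def)
  define y where "y = k / (k + \<bar>z\<bar>)"
  have y: "0 < y" "y \<le> 1" using k by (auto simp: y_def)
  define s where "s = pi - arcsin y"
  have a: "0 < arcsin y" "arcsin y \<le> pi / 2"
    using y arcsin_less_arcsin[of 0 y] arcsin_ubound[of y] by auto
  then have s: "s \<in> radii" "pi / 2 \<le> s" unfolding radii_iff s_def by auto
  have "I (pi / 2) \<le> I s"
  proof (rule DERIV_nonneg_imp_nondecreasing[OF s(2)])
    fix x assume x: "pi / 2 \<le> x" "x \<le> s"
    have "0 < pi / 2" by simp
    then have "0 < x" using x by linarith
    moreover then have "x \<in> radii" using radii_down[OF s(1)] x by auto
    ultimately show "\<exists>y. (I has_real_derivative y) (at x) \<and> 0 \<le> y"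
      using DERIV_I[of x] sn_pos[of x] by (intro exI[of _ "sn x ^ m"]) (auto simp: less_imp_le)
  qed
  then have kI: "k \<le> I s" by (simp add: k_def)
  have sn: "sn s = y" using y assms by (simp add: sin_eps_def s_def)
  have "y ^ m \<le> y ^ 1" using y m by (intro power_decreasing) auto
  then have "k / y \<le> I s / y ^ m"
    using kI k y by (intro frac_le) auto
  also have "\<dots> = phi s" using s(1) by (subst phi_eq) (auto simp: sn radii_iff)
  finally have "k / y \<le> phi s" .
  moreover have "k / y = k + \<bar>z\<bar>" using k by (simp add: y_def)
  ultimately show ?thesis using s(1) k by (intro bexI[of _ s]) auto
qed

text \<open>
  The derivative of the left-hand side is at most \<open>sinh\<^sup>m\<close>: after clearing the denominator
  \<open>(m cosh + 1)\<^sup>2\<close> the difference is \<open>sinh\<^sup>m (m - 1) (1 - cosh) \<le> 0\<close>.  Dividing by \<open>sinh\<^sup>m\<close> yields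
  \<open>\<phi> \<ge> sinh / (m cosh + 1)\<close>, whose limit at infinity is \<open>1/m\<close>.
\<close>

lemma I_lower_bound_hyperbolic:
  assumes "eps = -1" "s > 0"
  shows "sn s ^ (m + 1) / (m * cs s + 1) \<le> I s"
proof -
  let ?g = "\<lambda>s. sn s ^ (m + 1) / (m * cs s + 1)"
  let ?g' = "\<lambda>s. ((m + 1) * sn s ^ m * cs s * (m * cs s + 1) - sn s ^ (m + 1) * (m * sn s)) / (m * cs s + 1)\<^sup>2"
  have c1: "cs x \<ge> 1" for x unfolding cs_def using assms by (simp add: cosh_real_ge_1)
  have D: "m * cs x + 1 > 0" for x
    using mult_nonneg_nonneg[of "real m" "cs x"] c1[of x] by linarith
  have "I 0 - ?g 0 \<le> I s - ?g s"
  proof (rule nondecreasing_between[where g = "\<lambda>s. I s - ?g s"])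
    show "continuous_on {0..s} (\<lambda>s. I s - ?g s)"
      using D by (auto intro!: continuous_intros continuous_on_I simp: less_imp_neq[OF D, symmetric])
    fix x assume x: "0 < x" "x < s"
    let ?S = "sn x" and ?c = "cs x"
    have es: "?S * ?S = ?c\<^sup>2 - 1"
      using pythagoras[of x] assms(1) by (simp add: power2_eq_square)
    have "x \<in> radii" unfolding radii_iff using x assms(1) by simp
    then have sn: "?S > 0" by (rule sn_pos)
    have dD: "((\<lambda>s. m * cs s + 1) has_real_derivative m * ?S) (at x)"
      by (rule derivative_eq_intros refl)+ (simp add: assms(1))
    show "((\<lambda>s. I s - ?g s) has_real_derivative ?S ^ m - ?g' x) (at x)"
      using D[of x]
      by (intro DERIV_cong[OF DERIV_diff[OF DERIV_I[OF x(1)] DERIV_divide[OF DERIV_sn_power dD]]])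
         (simp_all add: power2_eq_square)
    have "(m + 1) * ?S ^ m * ?c * (m * ?c + 1) - ?S ^ (m + 1) * (m * ?S)
        = ?S ^ m * ((m + 1) * ?c * (m * ?c + 1) - m * (?S * ?S))"
      by (simp add: algebra_simps)
    also have "\<dots> = ?S ^ m * ((m * ?c + 1)\<^sup>2 + (real m - 1) * (1 - ?c))"
      unfolding es by (simp add: algebra_simps power2_eq_square)
    also have "\<dots> \<le> ?S ^ m * (m * ?c + 1)\<^sup>2"
    proof (rule mult_left_mono)
      have "(real m - 1) * (1 - ?c) \<le> 0"
        using m c1[of x] by (intro mult_nonneg_nonpos) auto
      then show "(m * ?c + 1)\<^sup>2 + (real m - 1) * (1 - ?c) \<le> (m * ?c + 1)\<^sup>2" by simp
    qed (use sn in auto)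
    finally have "?g' x \<le> ?S ^ m"
      using D[of x] by (subst pos_divide_le_eq) auto
    then show "0 \<le> ?S ^ m - ?g' x" by simp
  qed (use assms in simp)
  then show ?thesis by simp
qed

text \<open>
  Together with the intermediate value theorem this provides a radius for every mean curvature
  above \<open>n - 1 = m\<close>.
\<close>

lemma phi_approaches_limit_hyperbolic:
  fixes H :: real
  assumes "eps = -1" "m < H"
  shows "\<exists>s\<in>radii. 1 / H \<le> phi s"
proof -
  have c1: "cs x \<ge> 1" for x unfolding cs_def using assms by (simp add: cosh_real_ge_1)
  \<comment> \<open>Where \<open>cosh s = c\<close>, the bound \<open>sinh s \<ge> c - 1\<close> makes \<open>H sinh s\<close> at least \<open>m cosh s + 1\<close>.\<close>
  define c where "c = 1 + (H + 1) / (H - m)"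
  have H: "H > 0" "H - m > 0" using assms m by auto
  then have c: "c > 1" by (simp add: c_def)
  define s where "s = arcosh c"
  have s0: "s > 0" using c by (simp add: s_def)
  have s: "s \<in> radii" unfolding radii_iff using s0 assms(1) by simp
  have cs: "cs s = c" unfolding cs_def s_def using c assms(1) by simp
  have D: "m * c + 1 > 0" using c by (simp add: add_nonneg_pos)
  have "c - sn s = exp (- s)"
    using cosh_minus_sinh[of s] cs assms(1) unfolding cs_def sin_eps_def by simp
  also have "\<dots> \<le> 1" using s0 by simp
  finally have sn: "sn s \<ge> c - 1" by simp
  have "H * (c - 1) - (m * c + 1) = (H - m) * (c - 1) - m - 1"
    by (simp add: left_diff_distrib right_diff_distrib)
  also have "(H - m) * (c - 1) = H + 1"
    using H by (simp add: c_def)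
  finally have "H * (c - 1) - (m * c + 1) = H - m" by simp
  then have "0 \<le> H * (c - 1) - (m * c + 1)" using H by simp
  then have "m * c + 1 \<le> H * (c - 1)" by (simp only: diff_ge_0_iff_ge)
  also have "\<dots> \<le> H * sn s" using sn H by (intro mult_left_mono) auto
  finally have "1 / H \<le> sn s / (m * c + 1)"
    using D H by (simp add: frac_le_eq divide_le_0_iff pos_le_divide_eq pos_divide_le_eq mult.commute)
  also have "\<dots> = sn s ^ (m + 1) / (m * cs s + 1) / sn s ^ m"
    using sn_pos[OF s] cs by simp
  also have "\<dots> \<le> I s / sn s ^ m"
    using I_lower_bound_hyperbolic[OF assms(1) s0] sn_pos[OF s] by (intro divide_right_mono) auto
  also have "\<dots> = phi s" using s0 by (simp add: phi_eq)
  finally show ?thesis using s by blast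
qed

lemma C_eps_nonneg: "C_eps (Suc m) eps \<ge> 0"
  by (simp add: C_eps_def)

lemma radius_exists:
  assumes "H > C_eps (Suc m) eps"
  obtains r where "r \<in> radii" "phi r = 1 / H"
proof -
  have H: "H > 0" using assms C_eps_nonneg by simp
  have "\<exists>b\<in>radii. 1 / H \<le> phi b"
  proof (cases "eps = 1")
    case True
    then show ?thesis by (rule phi_unbounded_sphere)
  next
    case False
    then have "eps = -1" "m < H" using assms eps by (auto simp: C_eps_def)
    then show ?thesis by (rule phi_approaches_limit_hyperbolic)
  qed
  then obtain b where b: "b \<in> radii" "1 / H \<le> phi b" by blast
  have "\<exists>x\<ge>0. x \<le> b \<and> phi x = 1 / H"
    using b H by (intro IVT' continuous_on_phi) (auto simp: radii_iff)
  then obtain x where x: "0 \<le> x" "x \<le> b" "phi x = 1 / H" by blast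
  then have "x \<noteq> 0" using H by auto
  then have "x \<in> radii" using x b radii_down[of b x] by auto
  then show ?thesis using that[of x] x by blast
qed

lemma phi_inj: "inj_on phi (insert 0 radii)"
proof (rule linorder_inj_onI')
  fix a b assume "a \<in> insert 0 radii" "b \<in> insert 0 radii" "a < b"
  then have "phi a < phi b" by (intro phi_strict_mono) (auto simp: radii_iff)
  then show "phi a \<noteq> phi b" by simp
qed

lemma radius_props:
  assumes "H > C_eps (Suc m) eps"
  shows "radius (Suc m) eps H \<in> radii" "phi (radius (Suc m) eps H) = 1 / H"
proof -
  obtain r where r: "r \<in> radii" "phi r = 1 / H" using radius_exists[OF assms] .
  have "radius (Suc m) eps H \<in> radii \<and> phi (radius (Suc m) eps H) = 1 / H"
  proof -
    have "\<exists>!s. s \<in> radii \<and> phi s = 1 / H"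
      using r phi_inj by (auto simp: inj_on_def)
    from theI'[OF this] show ?thesis
      by (simp add: radius_def radii_def conj_assoc)
  qed
  then show "radius (Suc m) eps H \<in> radii" "phi (radius (Suc m) eps H) = 1 / H" by auto
qed

lemma phi_le_cancel:
  assumes "a \<in> radii" "b \<in> radii" "phi a \<le> phi b"
  shows "a \<le> b"
proof (rule ccontr)
  assume "\<not> a \<le> b"
  moreover have "0 \<le> b" using assms(2) by (simp add: radii_iff)
  ultimately have "phi b < phi a"
    using assms(1) by (intro phi_strict_mono) simp_all
  then show False using assms(3) by simp
qed

lemma radius_antimono:
  assumes "H' < H" "C_eps (Suc m) eps < H'"
  shows "radius (Suc m) eps H \<le> radius (Suc m) eps H'"
proof (rule phi_le_cancel)
  have H: "C_eps (Suc m) eps < H" and "0 < H'"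
    using assms C_eps_nonneg by linarith+
  then show "phi (radius (Suc m) eps H) \<le> phi (radius (Suc m) eps H')"
    using assms by (simp add: radius_props(2) frac_le)
  show "radius (Suc m) eps H \<in> radii" "radius (Suc m) eps H' \<in> radii"
    using radius_props(1) H assms(2) by blast+
qed

section \<open>The height of the plane of symmetry as an integral over a fixed interval\<close>

definition phi_inv :: "real \<Rightarrow> real" where
  "phi_inv = the_inv_into (insert 0 radii) phi"

text \<open>
  The quotient \<open>\<phi> / \<phi>'\<close> as a function of the value of \<open>\<phi>\<close>.
\<close>

definition f :: "real \<Rightarrow> real" where
  "f z = F (phi_inv z)"

lemma phi_inv_phi: "s \<in> insert 0 radii \<Longrightarrow> phi_inv (phi s) = s"
  unfolding phi_inv_def by (rule the_inv_into_f_f[OF phi_inj])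

lemma phi_mono: "0 \<le> a \<Longrightarrow> a \<le> b \<Longrightarrow> b \<in> radii \<Longrightarrow> phi a \<le> phi b"
  using phi_strict_mono[of a b] by (cases "a = b") auto

lemma phi_image:
  assumes r: "r \<in> radii"
  shows "phi ` {0..r} = {0..phi r}"
proof (intro equalityI subsetI)
  fix z assume "z \<in> phi ` {0..r}"
  then obtain x where x: "0 \<le> x" "x \<le> r" "z = phi x" by auto
  have "phi 0 \<le> phi x"
  proof (cases "x = 0")
    case False
    then have "x \<in> radii" using x radii_down[OF r] by simp
    then show ?thesis using phi_pos[of x] by simp
  qed simp
  moreover have "phi x \<le> phi r" using x r by (intro phi_mono)
  ultimately show "z \<in> {0..phi r}" using x by simp
next
  fix z assume "z \<in> {0..phi r}"
  then have "\<exists>x\<ge>0. x \<le> r \<and> phi x = z"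
    using r by (intro IVT' continuous_on_phi) (auto simp: radii_iff)
  then show "z \<in> phi ` {0..r}" by auto
qed

lemma Icc_subset: "r \<in> radii \<Longrightarrow> {0..r} \<subseteq> insert 0 radii"
proof
  fix s assume "r \<in> radii" "s \<in> {0..r}"
  then show "s \<in> insert 0 radii" using radii_down[of r s] by (cases "s = 0") simp_all
qed

lemma phi_inv_works:
  assumes "r \<in> radii" "0 \<le> z" "z \<le> phi r"
  shows "phi_inv z \<in> {0..r}" "phi (phi_inv z) = z"
proof -
  have "z \<in> phi ` {0..r}" using assms by (simp add: phi_image)
  then obtain s where s: "s \<in> {0..r}" "z = phi s" by blast
  then have "phi_inv z = s" using Icc_subset[OF assms(1)] by (auto intro!: phi_inv_phi)
  then show "phi_inv z \<in> {0..r}" "phi (phi_inv z) = z" using s by auto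
qed

lemma continuous_on_psi:
  assumes "r \<in> radii"
  shows "continuous_on {0..phi r} phi_inv"
  unfolding phi_image[OF assms, symmetric]
  by (rule continuous_on_inv[OF continuous_on_phi[OF assms]])
     (use Icc_subset[OF assms] in \<open>auto intro!: phi_inv_phi\<close>)

lemma continuous_on_f:
  assumes "r \<in> radii"
  shows "continuous_on {0..phi r} f"
  unfolding f_def[abs_def]
  by (rule continuous_on_compose2[OF continuous_on_F[OF assms] continuous_on_psi[OF assms]])
     (use phi_inv_works[OF assms] in auto)

text \<open>
  The substitution \<open>\<theta> = arcsin (H \<phi> s)\<close>.  From \<open>d\<theta> = H \<phi>' / sqrt (1 - H\<^sup>2 \<phi>\<^sup>2) ds\<close> and
  \<open>f (sin \<theta> / H) = \<phi> / \<phi>'\<close> the integrand becomes the continuous function \<open>f (sin \<theta> / H)\<close>, which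
  proves at the same time that the singular integral exists.
\<close>

lemma slope_has_integral:
  assumes H: "H > C_eps (Suc m) eps"
  shows "((\<lambda>u. H * phi u / sqrt (1 - H\<^sup>2 * (phi u)\<^sup>2)) has_integral
      integral {0..pi/2} (\<lambda>\<theta>. f (sin \<theta> / H))) {0..radius (Suc m) eps H}"
proof -
  define r where "r = radius (Suc m) eps H"
  have r: "r \<in> radii" "phi r = 1 / H" using radius_props[OF H] by (auto simp: r_def)
  have r0: "0 < r" using r(1) by (simp add: radii_iff)
  have H0: "H > 0" using H C_eps_nonneg by simp
  let ?g = "\<lambda>s. arcsin (H * phi s)"
  \<comment> \<open>At both endpoints the product of this formula with \<open>f\<close> agrees with the slope: at \<open>0\<close> both are
    \<open>0\<close>, and at \<open>r\<close> both are quotients by \<open>0\<close>.\<close>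
  let ?g' = "\<lambda>s. H * (J s / sn s ^ (m + 1)) / sqrt (1 - H\<^sup>2 * (phi s)\<^sup>2)"
  have range: "0 \<le> H * phi s \<and> H * phi s \<le> 1" if "s \<in> {0..r}" for s
  proof -
    have "phi s \<in> {0..phi r}" using phi_image[OF r(1)] that by blast
    then show ?thesis using H0 r(2) by (auto simp: field_simps)
  qed
  have "((\<lambda>x. ?g' x *\<^sub>R f (sin (?g x) / H)) has_integral (integral {?g 0..?g r} (\<lambda>\<theta>. f (sin \<theta> / H)))) {0..r}"
  proof (rule has_integral_substitution_strong[where s = "{0,r}" and c = 0 and d = "pi/2"])
    show "?g 0 \<le> ?g r" using r H0 by simp
    show "?g ` {0..r} \<subseteq> {0..pi / 2}"
    proof safe
      fix s assume s: "s \<in> {0..r}"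
      show "arcsin (H * phi s) \<in> {0..pi/2}"
        using range[OF s] arcsin_le_arcsin[of 0 "H * phi s"] arcsin_ubound[of "H * phi s"] by simp
    qed
    show "continuous_on {0..pi/2} (\<lambda>\<theta>. f (sin \<theta> / H))"
    proof (rule continuous_on_compose2[OF continuous_on_f[OF r(1)]])
      show "continuous_on {0..pi/2} (\<lambda>\<theta>. sin \<theta> / H)" using H0 by (auto intro!: continuous_intros)
      show "(\<lambda>\<theta>. sin \<theta> / H) ` {0..pi/2} \<subseteq> {0..phi r}"
        using H0 r(2) by (auto intro!: divide_nonneg_pos sin_ge_zero divide_right_mono)
    qed
    show "continuous_on {0..r} ?g"
      using range by (intro continuous_on_arcsin continuous_intros continuous_on_phi r(1)) force
  next
    fix x assume x: "x \<in> {0..r} - {0, r}"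
    then have xr: "x \<in> radii" using radii_down[OF r(1), of x] by auto
    have "phi x < 1 / H" using phi_strict_mono[of x r] x r by auto
    then have lt: "H * phi x < 1" using H0 by (simp add: field_simps)
    have pos: "H * phi x > 0" using phi_pos[OF xr] H0 by simp
    have "(?g has_real_derivative ?g' x) (at x)"
      by (rule DERIV_cong[OF DERIV_chain2[OF DERIV_arcsin DERIV_cmult[OF DERIV_phi[OF xr]]]])
         (use lt pos in \<open>auto simp: power_mult_distrib field_simps\<close>)
    then show "(?g has_real_derivative ?g' x) (at x within {0..r})"
      by (rule has_field_derivative_at_within)
  qed (use r0 in auto)
  also have "?g 0 = 0" by simp
  also have "?g r = pi / 2" using r(2) H0 by simp
  finally have int: "((\<lambda>x. ?g' x *\<^sub>R f (sin (?g x) / H)) has_integral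
      (integral {0..pi/2} (\<lambda>\<theta>. f (sin \<theta> / H)))) {0..r}" .
  have eq: "?g' x *\<^sub>R f (sin (?g x) / H) = H * phi x / sqrt (1 - H\<^sup>2 * (phi x)\<^sup>2)"
    if x: "x \<in> {0..r}" for x
  proof (cases "x = 0")
    case True
    have "phi_inv 0 = 0" using phi_inv_phi[of 0] by simp
    then show ?thesis using True by (simp add: f_def)
  next
    case False
    then have xr: "x \<in> radii" using x radii_down[OF r(1), of x] by auto
    have "f (sin (?g x) / H) = F x"
      using range[OF x] H0 phi_inv_phi[of x] xr by (simp add: f_def)
    then show ?thesis
      using J_pos[OF xr] sn_pos[OF xr] by (simp add: F_eq[OF xr])
  qed
  show ?thesis
    unfolding r_def[symmetric] by (rule has_integral_eq[OF eq int])
qed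

lemma sym_height_eq:
  assumes "H > C_eps (Suc m) eps"
  shows "sym_height (Suc m) eps H = integral {0..pi/2} (\<lambda>\<theta>. f (sin \<theta> / H))"
  unfolding sym_height_def meridian_def by (rule integral_unique[OF slope_has_integral[OF assms]])

lemma phi_inv_mono:
  assumes "r \<in> radii" "0 \<le> y" "y \<le> z" "z \<le> phi r"
  shows "phi_inv y \<le> phi_inv z"
proof (rule ccontr)
  note y = phi_inv_works[OF assms(1,2) order_trans[OF assms(3,4)]]
  note z = phi_inv_works[OF assms(1) order_trans[OF assms(2,3)] assms(4)]
  assume "\<not> phi_inv y \<le> phi_inv z"
  then have lt: "phi_inv z < phi_inv y" by simp
  have "0 \<le> phi_inv z" "phi_inv y \<le> r" using y(1) z(1) by simp_all
  moreover from this lt have "phi_inv y \<in> radii" using radii_down[OF assms(1), of "phi_inv y"] by linarith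
  ultimately have "phi (phi_inv z) < phi (phi_inv y)" using lt by (intro phi_strict_mono)
  then show False unfolding y(2) z(2) using assms(3) by simp
qed

lemma f_integrable:
  assumes "H > C_eps (Suc m) eps"
  shows "(\<lambda>\<theta>. f (sin \<theta> / H)) integrable_on {0..pi/2}"
proof (rule integrable_continuous_real, rule continuous_on_compose2[OF continuous_on_f])
  have H: "0 < H" using assms C_eps_nonneg by simp
  show "radius (Suc m) eps H \<in> radii" by (rule radius_props(1)[OF assms])
  show "continuous_on {0..pi / 2} (\<lambda>\<theta>. sin \<theta> / H)" using H by (auto intro!: continuous_intros)
  show "(\<lambda>\<theta>. sin \<theta> / H) ` {0..pi / 2} \<subseteq> {0..phi (radius (Suc m) eps H)}"
    using H by (auto simp: radius_props(2)[OF assms] intro!: divide_nonneg_pos sin_ge_zero divide_right_mono)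
qed

text \<open>
  A larger \<open>H\<close> evaluates \<open>F\<close> at smaller radii for each \<open>\<theta>\<close>, and \<open>F\<close> is increasing on the inner
  range.
\<close>

lemma height_antimono_inner:
  assumes "H' < H" "C_eps (Suc m) eps < H'" and inner: "radius (Suc m) eps H' \<in> inner_range"
  shows "sym_height (Suc m) eps H \<le> sym_height (Suc m) eps H'"
proof -
  have H: "C_eps (Suc m) eps < H" "0 < H'" using assms C_eps_nonneg by linarith+
  let ?r = "radius (Suc m) eps H'"
  note r = radius_props[OF assms(2)]
  show ?thesis
    unfolding sym_height_eq[OF assms(2)] sym_height_eq[OF H(1)]
  proof (rule integral_le[OF f_integrable[OF H(1)] f_integrable[OF assms(2)]])
    fix \<theta> :: real assume "\<theta> \<in> {0..pi/2}"
    then have s: "0 \<le> sin \<theta>" by (intro sin_ge_zero) auto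
    have le: "0 \<le> sin \<theta> / H" "sin \<theta> / H \<le> sin \<theta> / H'" "sin \<theta> / H' \<le> phi ?r"
      using s H(2) assms(1) by (auto simp: r(2) intro!: divide_left_mono divide_right_mono)
    note p = phi_inv_works(1)[OF r(1) le(1) order_trans[OF le(2,3)]]
    note p' = phi_inv_works(1)[OF r(1) order_trans[OF le(1,2)] le(3)]
    show "f (sin \<theta> / H) \<le> f (sin \<theta> / H')"
      unfolding f_def
    proof (cases "phi_inv (sin \<theta> / H') = 0")
      case True
      then have "phi_inv (sin \<theta> / H) = 0" using phi_inv_mono[OF r(1) le] p by simp
      then show "F (phi_inv (sin \<theta> / H)) \<le> F (phi_inv (sin \<theta> / H'))" using True by simp
    next
      case False
      then have "phi_inv (sin \<theta> / H') \<in> inner_range"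
        using p' inner_range_down[OF inner] by simp
      then show "F (phi_inv (sin \<theta> / H)) \<le> F (phi_inv (sin \<theta> / H'))"
        using p phi_inv_mono[OF r(1) le] by (intro F_mono_inner) auto
    qed
  qed
qed

end

section \<open>Averages of slowly decaying functions\<close>

lemma half_le_sin:
  assumes "0 \<le> x" "x \<le> pi / 3"
  shows "x / 2 \<le> sin x"
proof -
  have "(\<lambda>x. sin x - x / 2) 0 \<le> (\<lambda>x. sin x - x / 2) x"
  proof (rule DERIV_nonneg_imp_nondecreasing[OF assms(1)])
    fix y assume y: "0 \<le> y" "y \<le> x"
    have "cos (pi / 3) \<le> cos y" using y assms by (subst cos_mono_le_eq) auto
    then have "0 \<le> cos y - 1 / 2" by (simp add: cos_60)
    moreover have "((\<lambda>x. sin x - x / 2) has_real_derivative cos y - 1 / 2) (at y)"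
      by (auto intro!: derivative_eq_intros)
    ultimately show "\<exists>z. ((\<lambda>x. sin x - x / 2) has_real_derivative z) (at y) \<and> 0 \<le> z" by blast
  qed
  then show ?thesis by simp
qed

text \<open>
  Sine increases on \<open>[0, \<pi>/2]\<close>, so the bound at the left end of an interval controls all of it.
\<close>

lemma half_le_sin_above:
  assumes "0 \<le> a" "a \<le> pi / 3" "a \<le> x" "x \<le> pi / 2"
  shows "a / 2 \<le> sin x"
  using half_le_sin[OF assms(1,2)] sin_monotone_2pi_le[of a x] assms by linarith

text \<open>
  The properties of \<open>f\<close> on which the behaviour of the height for small \<open>H\<close> rests: growth at a
  bounded rate, and decay beyond \<open>T\<close> at least as fast as that of \<open>c / z\<close>, that is, \<open>f(z) - c/z\<close> is
  nonincreasing there.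
\<close>

locale slowly_decaying =
  fixes f :: "real \<Rightarrow> real" and L T c :: real
  assumes cont: "\<And>b. continuous_on {0..b} f"
    and zero: "f 0 = 0"
    and lipschitz: "\<And>a b. 0 \<le> a \<Longrightarrow> a \<le> b \<Longrightarrow> f b - f a \<le> L * (b - a)"
    and decay: "\<And>a b. T \<le> a \<Longrightarrow> a \<le> b \<Longrightarrow> f b - f a \<le> c / b - c / a"
    and pos: "T > 0" "c > 0" "L > 0"
begin

definition average :: "real \<Rightarrow> real" where
  "average z = integral {0..pi/2} (\<lambda>\<theta>. f (z * sin \<theta>))"

lemma integrable:
  assumes "0 \<le> z" "0 \<le> a" "b \<le> pi / 2"
  shows "(\<lambda>\<theta>. f (z * sin \<theta>)) integrable_on {a..b}"
proof (rule integrable_continuous_real, rule continuous_on_compose2[OF cont])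
  show "continuous_on {a..b} (\<lambda>\<theta>. z * sin \<theta>)" by (intro continuous_intros)
  show "(\<lambda>\<theta>. z * sin \<theta>) ` {a..b} \<subseteq> {0..z}"
    using assms by (auto intro!: mult_nonneg_nonneg sin_ge_zero mult_left_le)
qed

text \<open>
  Split the integral of \<open>f (z2 sin \<theta>) - f (z1 sin \<theta>)\<close> at \<open>\<delta> = 2 T / z1\<close>.  Below \<open>\<delta>\<close> the growth
  bound gives at most \<open>L (z2 - z1) \<delta>\<^sup>2\<close>, which is of order \<open>(z2 - z1) / z1\<^sup>2\<close>.  Above \<open>\<delta>\<close> both
  arguments are at least \<open>T\<close>, because \<open>sin \<theta> \<ge> \<delta> / 2\<close>, and the integrand is at most
  \<open>- c (z2 - z1) / (z1 z2 sin \<theta>)\<close>; its integral is of order \<open>- (z2 - z1) / z1\<^sup>2\<close> times \<open>ln (1 / \<delta>)\<close>.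
  The logarithm wins once \<open>z1\<close> is large.  The restriction \<open>z2 \<le> 2 z1\<close> only serves to replace \<open>z2\<close>
  by \<open>z1\<close> in the denominators.
\<close>

lemma average_decreasing_step:
  assumes z: "4 * T * exp (8 * L * T\<^sup>2 / c + 1) \<le> z1" "z1 < z2" "z2 \<le> 2 * z1"
  shows "average z2 < average z1"
proof -
  let ?K = "8 * L * T\<^sup>2 / c"
  have "?K \<ge> 0" using pos by simp
  then have "1 \<le> exp (?K + 1)" by simp
  then have "4 * T * 1 \<le> 4 * T * exp (?K + 1)" using pos by (intro mult_left_mono) auto
  then have z1: "4 * T \<le> z1" "0 < z1" "0 < z2" using z pos by linarith+
  define \<delta> where "\<delta> = 2 * T / z1"
  have d: "0 < \<delta>" "\<delta> \<le> 1 / 2" using z1 pos by (auto simp: \<delta>_def field_simps)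
  then have d2: "\<delta> \<le> pi / 3" "\<delta> \<le> pi / 2" using pi_gt3 by linarith+
  define g where "g = (\<lambda>\<theta>. f (z2 * sin \<theta>) - f (z1 * sin \<theta>))"
  define q where "q = c * (z2 - z1) / (2 * z1\<^sup>2)"
  have int: "g integrable_on {a..b}" if "0 \<le> a" "b \<le> pi / 2" for a b
    unfolding g_def using that z1 by (intro integrable_diff integrable) auto
  have "integral {0..\<delta>} g \<le> integral {0..\<delta>} (\<lambda>_. L * (z2 - z1) * \<delta>)"
  proof (rule integral_le)
    show "g integrable_on {0..\<delta>}" using d2 by (intro int) auto
    fix x assume x: "x \<in> {0..\<delta>}"
    have s: "0 \<le> sin x" using x d2 by (intro sin_ge_zero) auto
    have "sin x \<le> x" using x by (intro sin_x_le_x) auto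
    then have s2: "sin x \<le> \<delta>" using x by simp
    have "g x \<le> L * (z2 * sin x - z1 * sin x)"
      unfolding g_def using s z z1 by (intro lipschitz mult_nonneg_nonneg mult_right_mono) auto
    also have "\<dots> = L * (z2 - z1) * sin x" by (simp add: algebra_simps)
    also have "\<dots> \<le> L * (z2 - z1) * \<delta>"
      using s2 pos z by (intro mult_left_mono) auto
    finally show "g x \<le> L * (z2 - z1) * \<delta>" .
  qed (rule integrable_const_ivl)
  also have "\<dots> = L * (z2 - z1) * \<delta>\<^sup>2" using d by (simp add: power2_eq_square)
  finally have 1: "integral {0..\<delta>} g \<le> L * (z2 - z1) * \<delta>\<^sup>2" .
  have ln: "((\<lambda>x. - q / x) has_integral (- q * ln (pi/2) - - q * ln \<delta>)) {\<delta>..pi/2}"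
    by (rule fundamental_theorem_of_calculus[OF d2(2)])
       (use d in \<open>auto intro!: derivative_eq_intros simp flip: has_real_derivative_iff_has_vector_derivative\<close>)
  have "integral {\<delta>..pi/2} g \<le> integral {\<delta>..pi/2} (\<lambda>x. - q / x)"
  proof (rule integral_le)
    show "g integrable_on {\<delta>..pi/2}" using d by (intro int) auto
    show "(\<lambda>x. - q / x) integrable_on {\<delta>..pi/2}" using ln by blast
    fix x assume x: "x \<in> {\<delta>..pi/2}"
    have s: "\<delta> / 2 \<le> sin x" using half_le_sin_above[of \<delta> x] d d2 x by auto
    then have s0: "0 < sin x" using d by linarith
    have "sin x \<le> x" using x d by (intro sin_x_le_x) auto
    have "z1 * (\<delta> / 2) \<le> z1 * sin x" using s z1 by (intro mult_left_mono) auto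
    then have T: "T \<le> z1 * sin x" using z1 by (simp add: \<delta>_def)
    have "g x \<le> c / (z2 * sin x) - c / (z1 * sin x)"
      unfolding g_def using s0 z by (intro decay T mult_right_mono) auto
    also have "\<dots> = - (c * (z2 - z1) / (z1 * z2 * sin x))"
      using s0 z1 by (simp add: field_simps)
    also have "\<dots> \<le> - (c * (z2 - z1) / (2 * z1\<^sup>2 * x))"
    proof -
      have "z1 * z2 * sin x \<le> z1 * (2 * z1) * x"
        using z z1 s0 \<open>sin x \<le> x\<close> by (intro mult_mono) auto
      then have "c * (z2 - z1) / (2 * z1\<^sup>2 * x) \<le> c * (z2 - z1) / (z1 * z2 * sin x)"
        using s0 z1 z pos \<open>sin x \<le> x\<close>
        by (intro divide_left_mono) (auto simp: power2_eq_square intro!: mult_pos_pos)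
      then show ?thesis by simp
    qed
    also have "\<dots> = - q / x" by (simp add: q_def)
    finally show "g x \<le> - q / x" .
  qed
  also have "\<dots> = - q * ln (pi/2) - - q * ln \<delta>" using ln by blast
  also have "\<dots> = - q * ln (pi / 2 / \<delta>)" using d by (subst ln_divide_pos) (simp_all add: algebra_simps)
  finally have 2: "integral {\<delta>..pi/2} g \<le> - q * ln (pi / 2 / \<delta>)" .
  have "?K + 1 = ln (exp (?K + 1))" by simp
  also have "\<dots> \<le> ln (pi / 2 / \<delta>)"
  proof (rule ln_mono)
    have "4 * T * exp (?K + 1) * 1 \<le> z1 * pi" using z z1 pi_gt3 by (intro mult_mono) auto
    then show "exp (?K + 1) \<le> pi / 2 / \<delta>" using z1 pos by (simp add: \<delta>_def field_simps)
  qed (use d in auto)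
  finally have "?K < ln (pi / 2 / \<delta>)" by simp
  moreover have "q > 0" unfolding q_def using pos z z1 by (intro divide_pos_pos mult_pos_pos) auto
  ultimately have "q * ?K < q * ln (pi / 2 / \<delta>)" by (rule mult_strict_left_mono)
  moreover have "q * ?K = L * (z2 - z1) * \<delta>\<^sup>2"
    using pos z1 by (simp add: q_def \<delta>_def field_simps power2_eq_square)
  moreover have "average z2 - average z1 = integral {0..pi/2} g"
    unfolding average_def g_def using z1 by (intro integral_diff[symmetric] integrable) auto
  moreover have "integral {0..\<delta>} g + integral {\<delta>..pi/2} g = integral {0..pi/2} g"
    using d d2 by (intro Henstock_Kurzweil_Integration.integral_combine int) auto
  ultimately show ?thesis using 1 2 by linarith
qed

text \<open>
  Any \<open>z2 > z1\<close> is reached from \<open>z1\<close> by finitely many doublings followed by one shorter step.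
\<close>

lemma average_eventually_decreasing:
  assumes "4 * T * exp (8 * L * T\<^sup>2 / c + 1) \<le> z1" "z1 < z2"
  shows "average z2 < average z1"
proof -
  have "0 < 4 * T * exp (8 * L * T\<^sup>2 / c + 1)" using pos by simp
  then have z1: "0 < z1" using assms by linarith
  obtain k where "z2 / z1 < 2 ^ k" using real_arch_pow[of 2 "z2 / z1"] by auto
  then have "z2 \<le> 2 ^ k * z1" using z1 by (simp add: field_simps)
  with assms show ?thesis
  proof (induction k arbitrary: z1)
    case 0
    then show ?case by simp
  next
    case (Suc k)
    show ?case
    proof (cases "z2 \<le> 2 * z1")
      case True
      then show ?thesis using average_decreasing_step Suc.prems by blast
    next
      case False
      have "0 < z1" using Suc.prems pos
        by (smt (verit) exp_gt_zero mult_pos_pos)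
      then have z: "4 * T * exp (8 * L * T\<^sup>2 / c + 1) \<le> 2 * z1" "2 * z1 < z2" "z2 \<le> 2 ^ k * (2 * z1)"
        using False Suc.prems by auto
      have "average z2 < average (2 * z1)" by (rule Suc.IH[OF z])
      also have "\<dots> < average z1"
        using Suc.prems \<open>0 < z1\<close> by (intro average_decreasing_step) auto
      finally show ?thesis .
    qed
  qed
qed

text \<open>
  The same splitting, now at \<open>2 S / z\<close>, where \<open>f\<close> is small beyond \<open>S\<close>: the part below the splitting
  point is of order \<open>1 / z\<close> because \<open>f\<close> is bounded by \<open>2 L S\<close> there.
\<close>

lemma average_tendsto_zero:
  assumes nonneg: "\<And>z. 0 \<le> z \<Longrightarrow> 0 \<le> f z" and lim: "(f \<longlongrightarrow> 0) at_top"
  shows "(average \<longlongrightarrow> 0) at_top"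
proof (rule tendstoI)
  fix e :: real assume e: "0 < e"
  have "\<forall>\<^sub>F z in at_top. dist (f z) 0 < e / 4"
    using tendstoD[OF lim, of "e / 4"] e by simp
  then obtain S0 where S0: "\<And>z. z \<ge> S0 \<Longrightarrow> dist (f z) 0 < e / 4"
    by (auto simp: eventually_at_top_linorder)
  define S where "S = max S0 1"
  have S: "S > 0" "\<And>z. z \<ge> S \<Longrightarrow> f z \<le> e / 4" using S0 by (force simp: S_def)+
  have "\<forall>\<^sub>F z in at_top. z \<ge> max (4 * S) (16 * L * S\<^sup>2 / e)" by (rule eventually_ge_at_top)
  then show "\<forall>\<^sub>F z in at_top. dist (average z) 0 < e"
  proof eventually_elim
    case (elim z)
    then have z: "4 * S \<le> z" "16 * L * S\<^sup>2 / e \<le> z" by auto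
    then have z0: "z > 0" using S by linarith
    define \<delta> where "\<delta> = 2 * S / z"
    have d: "0 < \<delta>" "\<delta> \<le> 1 / 2" using z z0 S by (auto simp: \<delta>_def field_simps)
    then have d2: "\<delta> \<le> pi / 3" "\<delta> \<le> pi / 2" using pi_gt3 by linarith+
    let ?g = "\<lambda>\<theta>. f (z * sin \<theta>)"
    have "integral {0..\<delta>} ?g \<le> integral {0..\<delta>} (\<lambda>_. L * (z * \<delta>))"
    proof (rule integral_le)
      show "?g integrable_on {0..\<delta>}" using d2 z0 by (intro integrable) auto
      fix x assume x: "x \<in> {0..\<delta>}"
      have s: "0 \<le> sin x" using x d2 by (intro sin_ge_zero) auto
      have "sin x \<le> x" using x by (intro sin_x_le_x) auto
      then have s2: "sin x \<le> \<delta>" using x by simp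
      have "?g x \<le> L * (z * sin x)"
        using lipschitz[of 0 "z * sin x"] zero s z0 by simp
      also have "\<dots> \<le> L * (z * \<delta>)" using s2 pos z0 by (intro mult_left_mono) auto
      finally show "?g x \<le> L * (z * \<delta>)" .
    qed (rule integrable_const_ivl)
    also have "\<dots> = 4 * L * S\<^sup>2 / z" using d z0 by (simp add: \<delta>_def power2_eq_square)
    also have "\<dots> \<le> e / 4" using z z0 e by (simp add: field_simps)
    finally have 1: "integral {0..\<delta>} ?g \<le> e / 4" .
    have "integral {\<delta>..pi/2} ?g \<le> integral {\<delta>..pi/2} (\<lambda>_. e / 4)"
    proof (rule integral_le)
      show "?g integrable_on {\<delta>..pi/2}" using d z0 by (intro integrable) auto
      fix x assume x: "x \<in> {\<delta>..pi/2}"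
      have "\<delta> / 2 \<le> sin x" using half_le_sin_above[of \<delta> x] d d2 x by auto
      then have "z * (\<delta> / 2) \<le> z * sin x" using z0 by (intro mult_left_mono) auto
      then show "?g x \<le> e / 4" using z0 by (intro S) (simp add: \<delta>_def)
    qed (rule integrable_const_ivl)
    also have "\<dots> = (pi / 2 - \<delta>) * (e / 4)" using d2 by simp
    also have "\<dots> \<le> 2 * (e / 4)" using d e pi_less_4 by (intro mult_right_mono) auto
    finally have 2: "integral {\<delta>..pi/2} ?g \<le> e / 2" by simp
    have "integral {0..\<delta>} ?g + integral {\<delta>..pi/2} ?g = average z"
      unfolding average_def using d d2 z0 by (intro Henstock_Kurzweil_Integration.integral_combine integrable) auto
    then have "average z < e" using 1 2 e by linarith
    moreover have "0 \<le> average z"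
      unfolding average_def using z0
      by (intro integral_nonneg integrable) (auto intro!: nonneg mult_nonneg_nonneg sin_ge_zero)
    ultimately show ?case by simp
  qed
qed

end

section \<open>Small mean curvature on the sphere\<close>

locale spherical_profile = rotational_profile +
  assumes spherical: "eps = 1"
begin

lemma phi_inv_global:
  assumes "0 \<le> z"
  shows "phi_inv z \<in> insert 0 radii" "phi (phi_inv z) = z"
proof -
  obtain r where r: "r \<in> radii" "z \<le> phi r" using phi_unbounded_sphere[OF spherical] by blast
  show "phi_inv z \<in> insert 0 radii" "phi (phi_inv z) = z"
    using phi_inv_works[OF r(1) assms r(2)] Icc_subset[OF r(1)] by auto
qed

lemma continuous_on_f_global: "continuous_on {0..b} f"
proof -
  obtain r where r: "r \<in> radii" "b \<le> phi r" using phi_unbounded_sphere[OF spherical] by blast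
  show ?thesis by (rule continuous_on_subset[OF continuous_on_f[OF r(1)]]) (use r in auto)
qed

lemma phi_inv_mono_global:
  assumes "0 \<le> y" "y \<le> z"
  shows "phi_inv y \<le> phi_inv z"
proof -
  obtain r where r: "r \<in> radii" "z \<le> phi r" using phi_unbounded_sphere[OF spherical] by blast
  show ?thesis by (rule phi_inv_mono[OF r(1) assms r(2)])
qed

lemma f_zero: "f 0 = 0"
  using phi_inv_phi[of 0] by (simp add: f_def)

lemma f_nonneg: "0 \<le> z \<Longrightarrow> 0 \<le> f z"
  using phi_inv_global(1)[of z] F_pos[of "phi_inv z"] by (auto simp: f_def)

text \<open>
  In terms of \<open>z = \<phi> s\<close> this bounds the derivative \<open>F' / \<phi>'\<close> of \<open>f\<close>.  Since \<open>Q \<le> sn\<^sup>m\<^sup>+\<^sup>1 J\<close>, one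
  has \<open>F' \<le> 1 / \<phi>'\<close>, and \<open>1 / \<phi>' \<le> m + 1\<close> by \<open>J_lower_bound_sphere\<close>.
\<close>

lemma F_slope_bound:
  assumes s: "s \<in> radii"
  shows "Q s / (J s)\<^sup>2 \<le> (m + 1)\<^sup>2 * (J s / sn s ^ (m + 1))"
proof -
  let ?A = "sn s ^ (m + 1)"
  have A: "?A > 0" using sn_pos[OF s] by simp
  note J = J_pos[OF s]
  have B: "?A \<le> (m + 1) * J s" using J_lower_bound_sphere[OF spherical s] by simp
  have "Q s = ?A * J s - m * (I s)\<^sup>2"
    by (simp add: Q_def J_def algebra_simps power2_eq_square power_add[symmetric] mult_2 mult_2_right)
  then have "Q s \<le> ?A * J s" by simp
  then have "Q s / (J s)\<^sup>2 \<le> ?A * J s / (J s)\<^sup>2" by (intro divide_right_mono) auto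
  also have "\<dots> = ?A / J s" using J by (simp add: power2_eq_square)
  also have "\<dots> \<le> m + 1" using B J by (simp add: pos_divide_le_eq)
  also have "m + 1 \<le> (m + 1)\<^sup>2 * (J s / ?A)"
  proof -
    have "1 \<le> (m + 1) * (J s / ?A)" using B A by (simp add: pos_le_divide_eq)
    then have "real (m + 1) * 1 \<le> (m + 1) * ((m + 1) * (J s / ?A))"
      by (rule mult_left_mono) simp
    then show ?thesis
      by (simp only: power2_eq_square mult.assoc of_nat_mult of_nat_power mult_1_right)
  qed
  finally show ?thesis by simp
qed

lemma f_one_sided_lipschitz:
  fixes a b :: real
  assumes "0 \<le> a" "a \<le> b"
  shows "f b - f a \<le> (m + 1)\<^sup>2 * (b - a)"
proof (cases "phi_inv b = 0")
  case True
  then have "b = 0" using phi_inv_global(2)[of b] assms by simp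
  then show ?thesis using assms by simp
next
  case False
  have le: "phi_inv a \<le> phi_inv b" by (rule phi_inv_mono_global[OF assms])
  have b: "phi_inv b \<in> radii" using phi_inv_global(1)[of b] False assms by simp
  have a: "0 \<le> phi_inv a" using phi_inv_global(1)[of a] assms by (auto simp: radii_iff)
  let ?g = "\<lambda>s. (m + 1)\<^sup>2 * phi s - F s"
  have "?g (phi_inv a) \<le> ?g (phi_inv b)"
  proof (rule nondecreasing_between[OF le])
    show "continuous_on {phi_inv a..phi_inv b} ?g"
      by (rule continuous_on_subset[of "{0..phi_inv b}"])
         (use a in \<open>auto intro!: continuous_intros continuous_on_phi continuous_on_F b\<close>)
    fix x assume "phi_inv a < x" "x < phi_inv b"
    then have x: "x \<in> radii" using a radii_down[OF b] by auto
    show "(?g has_real_derivative (m + 1)\<^sup>2 * (J x / sn x ^ (m + 1)) - Q x / (J x)\<^sup>2) (at x)"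
      by (rule DERIV_diff[OF DERIV_cmult[OF DERIV_phi[OF x]] DERIV_F[OF x]])
    show "0 \<le> (m + 1)\<^sup>2 * (J x / sn x ^ (m + 1)) - Q x / (J x)\<^sup>2"
      using F_slope_bound[OF x] by simp
  qed
  then show ?thesis
    using phi_inv_global(2)[of a] phi_inv_global(2)[of b] assms by (simp add: f_def right_diff_distrib)
qed

lemma I_pi_pos: "I pi > 0"
proof -
  have r: "pi / 2 \<in> radii" unfolding radii_iff by simp
  have "I (pi / 2) \<le> I pi"
  proof (rule nondecreasing_between[where g = I and g' = "\<lambda>x. sn x ^ m"])
    show "continuous_on {pi / 2..pi} I"
      by (rule continuous_on_subset[OF continuous_on_I]) auto
    fix x assume x: "pi / 2 < x" "x < pi"
    have "0 < pi / 2" by simp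
    then have x0: "0 < x" using x by linarith
    then show "(I has_real_derivative sn x ^ m) (at x)" by (rule DERIV_I)
    have "x \<in> radii" unfolding radii_iff using x x0 by simp
    then show "0 \<le> sn x ^ m" using sn_pos by (simp add: less_imp_le)
  qed simp
  then show ?thesis using I_pos[OF r] by simp
qed

lemma tendsto_at_pi:
  fixes g :: "real \<Rightarrow> real"
  assumes "continuous_on {0..pi} g"
  shows "(g \<longlongrightarrow> g pi) (at_left pi)"
proof -
  have "(g \<longlongrightarrow> g pi) (at pi within {0..pi})"
    using assms pi_ge_zero unfolding continuous_on_def by auto
  then show ?thesis by (simp add: at_within_Icc_at_left)
qed

lemma J_tendsto_at_pi: "(J \<longlongrightarrow> m * I pi) (at_left pi)"
proof -
  have "continuous_on {0..pi} J"
    unfolding J_def[abs_def] by (intro continuous_intros continuous_on_I)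
  moreover have "J pi = m * I pi"
    unfolding J_def cs_def sin_eps_def using spherical by simp
  ultimately show ?thesis using tendsto_at_pi[of J] by simp
qed

lemma Q_tendsto_at_pi: "(Q \<longlongrightarrow> - (m * (I pi)\<^sup>2)) (at_left pi)"
proof -
  have "continuous_on {0..pi} Q"
    unfolding Q_def[abs_def] by (intro continuous_intros continuous_on_I)
  moreover have "Q pi = - (m * (I pi)\<^sup>2)"
    unfolding Q_def cs_def sin_eps_def using spherical by simp
  ultimately show ?thesis using tendsto_at_pi[of Q] by simp
qed

lemma F_tendsto_at_pi: "(F \<longlongrightarrow> 0) (at_left pi)"
proof -
  have "continuous_on {0..pi} (\<lambda>s. I s * sn s)"
    by (intro continuous_intros continuous_on_I)
  then have "((\<lambda>s. I s * sn s / J s) \<longlongrightarrow> I pi * sn pi / (m * I pi)) (at_left pi)"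
    using I_pi_pos m by (intro tendsto_divide[OF tendsto_at_pi J_tendsto_at_pi]) auto
  moreover have "sn pi = 0" unfolding sin_eps_def using spherical by simp
  ultimately show ?thesis by (simp add: F_def[abs_def])
qed

lemma eventually_at_left_piD:
  assumes "eventually P (at_left pi)"
  shows "\<exists>d\<in>radii. \<forall>s. d \<le> s \<longrightarrow> s < pi \<longrightarrow> P s"
proof -
  obtain b where b: "b < pi" "\<And>y. b < y \<Longrightarrow> y < pi \<Longrightarrow> P y"
    using assms unfolding eventually_at_left_field by blast
  let ?d = "(max b 0 + pi) / 2"
  have d: "0 < ?d" "?d < pi" "b < ?d" using b(1) pi_gt_zero by (simp_all add: max_def)
  then have "?d \<in> radii" unfolding radii_iff by simp
  moreover have "P s" if "?d \<le> s" "s < pi" for s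
    using that d(3) by (intro b(2)) linarith+
  ultimately show ?thesis by blast
qed

lemma phi_inv_ge:
  assumes "d \<in> radii" "phi d \<le> z"
  shows "d \<le> phi_inv z" "phi_inv z \<in> radii" "phi_inv z < pi"
proof -
  have z: "0 < z" using phi_pos[OF assms(1)] assms(2) by simp
  then have z': "0 \<le> z" by simp
  have "phi_inv z \<noteq> 0"
  proof
    assume "phi_inv z = 0"
    then have "phi (phi_inv z) = 0" by simp
    then show False unfolding phi_inv_global(2)[OF z'] using z by simp
  qed
  then show r: "phi_inv z \<in> radii" using phi_inv_global(1)[OF z'] by blast
  show "d \<le> phi_inv z"
  proof (rule phi_le_cancel[OF assms(1) r])
    show "phi d \<le> phi (phi_inv z)" unfolding phi_inv_global(2)[OF z'] by (rule assms(2))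
  qed
  show "phi_inv z < pi" using r unfolding radii_iff using spherical by simp
qed

lemma f_tendsto_zero: "(f \<longlongrightarrow> 0) at_top"
proof (rule tendstoI)
  fix \<epsilon> :: real assume "0 < \<epsilon>"
  then have "\<forall>\<^sub>F s in at_left pi. dist (F s) 0 < \<epsilon>" by (rule tendstoD[OF F_tendsto_at_pi])
  from eventually_at_left_piD[OF this]
  obtain d where d: "d \<in> radii" "\<And>s. d \<le> s \<Longrightarrow> s < pi \<Longrightarrow> dist (F s) 0 < \<epsilon>"
    by blast
  have "\<forall>\<^sub>F z in at_top. phi d \<le> z" by (rule eventually_ge_at_top)
  then show "\<forall>\<^sub>F z in at_top. dist (f z) 0 < \<epsilon>"
  proof eventually_elim
    case (elim z)
    then show ?case unfolding f_def using d(2) phi_inv_ge[OF d(1)] by blast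
  qed
qed

text \<open>
  In terms of \<open>s\<close>, the claim is that \<open>F - c / \<phi>\<close> is nonincreasing near \<open>\<pi>\<close>.  At \<open>\<pi>\<close> the derivative
  of \<open>F\<close> has the limit \<open>- 1/m\<close>, whereas that of \<open>- 1 / \<phi>\<close> is \<open>(J / I\<^sup>2) sn\<^sup>m\<^sup>-\<^sup>1\<close> and thus bounded.  A
  small \<open>c\<close> therefore does not spoil the sign.
\<close>

lemma f_decay:
  "\<exists>T>0. \<exists>c>0. \<forall>a b. T \<le> a \<longrightarrow> a \<le> b \<longrightarrow> f b - f a \<le> c / b - c / a"
proof -
  define k where "k = I pi"
  have k: "k > 0" using I_pi_pos by (simp add: k_def)
  have m0: "real m > 0" using m by simp
  \<comment> \<open>Near \<open>\<pi>\<close> one has \<open>J / I\<^sup>2 < 2 m / k\<close>, so this \<open>c\<close> uses up half of the limit \<open>- 1/m\<close> of \<open>F'\<close>.\<close>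
  define c where "c = k / (4 * m\<^sup>2)"
  have c: "c > 0" using k m by (simp add: c_def)
  have "((\<lambda>s. Q s / (J s)\<^sup>2) \<longlongrightarrow> - (m * k\<^sup>2) / (m * k)\<^sup>2) (at_left pi)"
    using k m0 unfolding k_def
    by (intro tendsto_divide[OF Q_tendsto_at_pi tendsto_power[OF J_tendsto_at_pi]]) auto
  moreover have "- (m * k\<^sup>2) / (m * k)\<^sup>2 = - 1 / m"
    using k m0 by (simp add: power2_eq_square)
  ultimately have "((\<lambda>s. Q s / (J s)\<^sup>2) \<longlongrightarrow> - 1 / m) (at_left pi)" by simp
  moreover have "- 1 / m < - 1 / (2 * m)" using m0 by (simp add: field_simps)
  ultimately have ev1: "\<forall>\<^sub>F s in at_left pi. Q s / (J s)\<^sup>2 < - 1 / (2 * m)"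
    by (rule order_tendstoD(2))
  have "(I \<longlongrightarrow> k) (at_left pi)" unfolding k_def by (rule tendsto_at_pi[OF continuous_on_I])
  then have "((\<lambda>s. J s / (I s)\<^sup>2) \<longlongrightarrow> m * k / k\<^sup>2) (at_left pi)"
    using k unfolding k_def[symmetric]
    by (intro tendsto_divide[OF J_tendsto_at_pi[folded k_def] tendsto_power]) auto
  moreover have "m * k / k\<^sup>2 < 2 * m / k"
    using k m0 by (simp add: power2_eq_square field_simps)
  ultimately have ev2: "\<forall>\<^sub>F s in at_left pi. J s / (I s)\<^sup>2 < 2 * m / k"
    by (rule order_tendstoD(2))
  obtain d where d: "d \<in> radii"
    "\<And>s. d \<le> s \<Longrightarrow> s < pi \<Longrightarrow> Q s / (J s)\<^sup>2 < - 1 / (2 * m) \<and> J s / (I s)\<^sup>2 < 2 * m / k"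
    using eventually_at_left_piD[OF eventually_conj[OF ev1 ev2]] by blast
  let ?g = "\<lambda>s. c / phi s - F s"
  let ?g' = "\<lambda>s. - (c * (J s / sn s ^ (m + 1))) / (phi s * phi s) - Q s / (J s)\<^sup>2"
  have g: "?g s \<le> ?g t" if st: "d \<le> s" "s \<le> t" "t \<in> radii" for s t
  proof (rule nondecreasing_between[OF st(2)])
    have s0: "0 < s" using st(1) d(1) by (simp add: radii_iff)
    then have phi_ne: "phi x \<noteq> 0" if "x \<in> {s..t}" for x
      using phi_pos[OF radii_down[OF st(3), of x]] that by auto
    have sub: "{s..t} \<subseteq> {0..t}" using s0 by auto
    show "continuous_on {s..t} ?g"
      by (intro continuous_on_diff continuous_on_divide continuous_on_const ballI phi_ne
           continuous_on_subset[OF continuous_on_phi[OF st(3)] sub]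
           continuous_on_subset[OF continuous_on_F[OF st(3)] sub])
    fix x assume x: "s < x" "x < t"
    then have xr: "x \<in> radii" using s0 radii_down[OF st(3)] by auto
    have "x < pi" using xr unfolding radii_iff using spherical by simp
    then have bounds: "Q x / (J x)\<^sup>2 < - 1 / (2 * m)" "J x / (I x)\<^sup>2 < 2 * m / k"
      using d(2)[of x] x st by auto
    show "(?g has_real_derivative ?g' x) (at x)"
      by (rule DERIV_cong[OF DERIV_diff[OF DERIV_divide[OF DERIV_const DERIV_phi[OF xr]] DERIV_F[OF xr]]])
         (use phi_pos[OF xr] in simp_all)
    have S: "0 < sn x" "sn x \<le> 1"
      using sn_pos[OF xr] spherical by (auto simp: sin_eps_def)
    have "J x / sn x ^ (m + 1) / (phi x * phi x) = J x / (I x)\<^sup>2 * sn x ^ (m - 1)"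
    proof -
      have Sm: "sn x ^ m = sn x * sn x ^ (m - 1)" using m by (cases m) auto
      have "phi x = I x / (sn x * sn x ^ (m - 1))"
        unfolding Sm[symmetric] using xr by (intro phi_eq) (auto simp: radii_iff)
      moreover have "sn x ^ (m + 1) = sn x * (sn x * sn x ^ (m - 1))"
        unfolding Sm[symmetric] by simp
      moreover have "j / (a * (a * p)) / (i / (a * p) * (i / (a * p))) = j / i\<^sup>2 * p"
        if "a > 0" "p > 0" "i > 0" for a p i j :: real
        using that by (simp add: field_simps power2_eq_square)
      ultimately show ?thesis
        using S I_pos[OF xr] by simp
    qed
    also have "\<dots> \<le> J x / (I x)\<^sup>2 * 1"
      using S J_pos[OF xr] by (intro mult_left_mono power_le_one) auto
    also have "\<dots> \<le> 2 * m / k" using bounds by simp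
    finally have "c * (J x / sn x ^ (m + 1) / (phi x * phi x)) \<le> c * (2 * m / k)"
      using c by (intro mult_left_mono) auto
    also have "\<dots> = 1 / (2 * m)" using k m0 by (simp add: c_def power2_eq_square)
    finally have "c * (J x / sn x ^ (m + 1)) / (phi x * phi x) \<le> 1 / (2 * m)" by simp
    then show "0 \<le> ?g' x" using bounds(1) by (simp add: algebra_simps)
  qed
  have "f b - f a \<le> c / b - c / a" if ab: "phi d \<le> a" "a \<le> b" for a b
  proof -
    have b: "phi d \<le> b" using ab by simp
    have pos: "0 \<le> a" "0 \<le> b" using ab phi_pos[OF d(1)] by auto
    have "?g (phi_inv a) \<le> ?g (phi_inv b)"
      using ab b pos by (intro g phi_inv_ge[OF d(1)] phi_inv_mono_global)
    then show ?thesis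
      by (simp add: f_def phi_inv_global(2) pos)
  qed
  then show ?thesis using phi_pos[OF d(1)] c by blast
qed

lemma slowly_decaying_f: "\<exists>L T c. slowly_decaying f L T c"
proof -
  obtain T c where "T > 0" "c > 0" "\<And>a b. T \<le> a \<Longrightarrow> a \<le> b \<Longrightarrow> f b - f a \<le> c / b - c / a"
    using f_decay by blast
  then have "slowly_decaying f ((real m + 1)\<^sup>2) T c"
    using f_one_sided_lipschitz
    by unfold_locales (auto intro: continuous_on_f_global simp: f_zero add.commute)
  then show ?thesis by blast
qed

lemma height_eq_average:
  assumes "slowly_decaying f L T c" "0 < H"
  shows "sym_height (Suc m) eps H = slowly_decaying.average f (1 / H)"
proof -
  have "H > C_eps (Suc m) eps" using assms(2) spherical by (simp add: C_eps_def)
  then show ?thesis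
    by (simp add: sym_height_eq slowly_decaying.average_def[OF assms(1)])
qed

lemma height_eventually_increasing:
  "\<exists>\<eta>>0. strict_mono_on {0<..<\<eta>} (sym_height (Suc m) eps)"
proof -
  obtain L T c where sd: "slowly_decaying f L T c" using slowly_decaying_f by blast
  then interpret slowly_decaying f L T c .
  let ?Z = "4 * T * exp (8 * L * T\<^sup>2 / c + 1)"
  have Z: "?Z > 0" using pos by simp
  have "strict_mono_on {0<..<1 / ?Z} (sym_height (Suc m) eps)"
  proof (rule strict_mono_onI)
    fix H H' assume H: "H \<in> {0<..<1 / ?Z}" "H' \<in> {0<..<1 / ?Z}" "H < H'"
    then have "?Z \<le> 1 / H'" using Z by (simp add: field_simps)
    moreover have "1 / H' < 1 / H" using H by (simp add: frac_less2)
    ultimately have "average (1 / H) < average (1 / H')" by (rule average_eventually_decreasing)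
    then show "sym_height (Suc m) eps H < sym_height (Suc m) eps H'"
      using H by (simp add: height_eq_average[OF sd])
  qed
  then show ?thesis using Z by (intro exI[of _ "1 / ?Z"]) simp
qed

lemma height_tendsto_zero: "(sym_height (Suc m) eps \<longlongrightarrow> 0) (at_right 0)"
proof -
  obtain L T c where sd: "slowly_decaying f L T c" using slowly_decaying_f by blast
  then interpret slowly_decaying f L T c .
  have "filterlim (\<lambda>H::real. inverse H) at_top (at_right 0)"
    by (rule filterlim_inverse_at_top_right)
  moreover have "(average \<longlongrightarrow> 0) at_top"
    by (rule average_tendsto_zero[OF f_nonneg f_tendsto_zero])
  ultimately have "((\<lambda>H. average (inverse H)) \<longlongrightarrow> 0) (at_right 0)"
    by (rule filterlim_compose[rotated])
  moreover have "\<forall>\<^sub>F H in at_right 0. average (inverse H) = sym_height (Suc m) eps H"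
    unfolding eventually_at_right_field
    by (rule exI[of _ 1]) (simp add: height_eq_average[OF sd] inverse_eq_divide)
  ultimately show ?thesis by (rule Lim_transform_eventually)
qed

text \<open>
  For large \<open>H\<close> the radius is at most \<open>\<pi>/8\<close>, which is inside the inner range.
\<close>

lemma height_antimono_large:
  "\<exists>K\<ge>0. \<forall>H H'. K < H' \<and> H' < H \<longrightarrow> sym_height (Suc m) eps H \<le> sym_height (Suc m) eps H'"
proof -
  have r: "pi / 8 \<in> inner_range" unfolding inner_range_def by simp
  note r' = inner_range_radii[OF r]
  have p: "phi (pi / 8) > 0" by (rule phi_pos[OF r'])
  show ?thesis
  proof (intro exI[of _ "1 / phi (pi / 8)"] conjI allI impI)
    fix H H' assume H: "1 / phi (pi / 8) < H' \<and> H' < H"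
    have "0 < 1 / phi (pi / 8)" using p by simp
    then have H0: "0 < H'" using H by linarith
    then have C: "C_eps (Suc m) eps < H'" using spherical by (simp add: C_eps_def)
    note rad = radius_props[OF C]
    have "1 / H' \<le> phi (pi / 8)"
      using H H0 p by (simp add: pos_divide_less_eq pos_divide_le_eq mult.commute)
    then have "radius (Suc m) eps H' \<le> pi / 8"
      unfolding rad(2)[symmetric] by (rule phi_le_cancel[OF rad(1) r'])
    moreover have "0 < radius (Suc m) eps H'" using rad(1) unfolding radii_iff by blast
    ultimately have "radius (Suc m) eps H' \<in> inner_range" by (intro inner_range_down[OF r])
    then show "sym_height (Suc m) eps H \<le> sym_height (Suc m) eps H'"
      using H C by (intro height_antimono_inner) auto
  qed (use p in simp)
qed

lemma radius_tendsto_pi: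
  assumes "d < pi"
  shows "\<forall>\<^sub>F H in at_right 0. d \<le> radius (Suc m) eps H"
proof (cases "0 < d")
  case True
  then have d: "d \<in> radii" unfolding radii_iff using assms by simp
  have "d \<le> radius (Suc m) eps H" if H: "0 < H" "H < 1 / phi d" for H
  proof -
    have C: "C_eps (Suc m) eps < H" using H spherical by (simp add: C_eps_def)
    note rad = radius_props[OF C]
    have "phi d \<le> 1 / H"
      using H phi_pos[OF d] by (simp add: pos_less_divide_eq pos_le_divide_eq mult.commute)
    then show ?thesis
      unfolding rad(2)[symmetric] by (rule phi_le_cancel[OF d rad(1)])
  qed
  then show ?thesis
    unfolding eventually_at_right_field using phi_pos[OF d]
    by (intro exI[of _ "1 / phi d"]) auto
next
  case False
  have "0 \<le> radius (Suc m) eps H" if "0 < H" for H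
  proof -
    have C: "C_eps (Suc m) eps < H" using that spherical by (simp add: C_eps_def)
    have "radius (Suc m) eps H \<in> radii" by (rule radius_props(1)[OF C])
    then show ?thesis unfolding radii_iff by simp
  qed
  then have "\<forall>H>0. H < 1 \<longrightarrow> d \<le> radius (Suc m) eps H"
    using False by force
  then show ?thesis
    unfolding eventually_at_right_field by (intro exI[of _ 1]) simp
qed

end

section \<open>Distance and geodesics in the space forms\<close>

text \<open>
  The quadratic form restricted to the space form determines the distance from the base point by
  \<open>cs (d x) = e q p x\<close>.  All metric facts are derived from this relation.
\<close>

locale pointed_space_form = rotational_profile eps m for eps m +
  fixes p :: "(real ^ 'n::finite) \<times> real"
  assumes base_point: "p \<in> space_form eps" and dimension: "CARD('n) = Suc m"
begin

abbreviation X :: "((real ^ 'n) \<times> real) set" where "X \<equiv> space_form eps"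
abbreviation q :: "(real ^ 'n) \<times> real \<Rightarrow> (real ^ 'n) \<times> real \<Rightarrow> real" where "q \<equiv> qform eps"
abbreviation d :: "(real ^ 'n) \<times> real \<Rightarrow> real" where "d \<equiv> geo_dist eps p"

lemma q_linear:
  "q x (a *\<^sub>R y + b *\<^sub>R z) = a * q x y + b * q x z"
  "q (a *\<^sub>R y + b *\<^sub>R z) x = a * q y x + b * q z x"
  by (simp_all add: qform_def inner_add_left inner_add_right algebra_simps)

lemma q_commute: "q x y = q y x"
  by (simp add: qform_def inner_commute mult.commute)

lemma q_self: "x \<in> X \<Longrightarrow> q x x = e"
  by (simp add: space_form_def)

lemma q_sphere: "eps = 1 \<Longrightarrow> q x y = inner x y"
  by (simp add: qform_def inner_prod_def)

lemma norm_sphere: "eps = 1 \<Longrightarrow> x \<in> X \<Longrightarrow> norm x = 1"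
  using q_self[of x] q_sphere[of x x] by (simp add: norm_eq_1)

lemma snd_hyperboloid:
  assumes "eps = -1" "x \<in> X"
  shows "snd x > 0" "(snd x)\<^sup>2 = 1 + (norm (fst x))\<^sup>2"
  using assms
  by (auto simp: space_form_def qform_def power2_norm_eq_inner power2_eq_square[of "snd x"])

lemma norm_fst_less_snd:
  assumes "eps = -1" "x \<in> X"
  shows "norm (fst x) < snd x"
  using snd_hyperboloid[OF assms] by (intro power2_less_imp_less[of "norm (fst x)"]) auto

lemma closed_X: "closed X"
proof (cases "eps = 1")
  case True
  have "X = {x. inner (fst x) (fst x) + e * (snd x * snd x) = e}"
    using True by (auto simp: space_form_def qform_def)
  moreover have "closed \<dots>" by (intro closed_Collect_eq continuous_intros)
  ultimately show ?thesis by simp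
next
  case False
  have "X = {x. inner (fst x) (fst x) + e * (snd x * snd x) = e} \<inter> {x. 0 \<le> snd x}"
  proof -
    have "snd x > 0" if "inner (fst x) (fst x) + e * (snd x * snd x) = e" "0 \<le> snd x" for x :: "(real ^ 'n) \<times> real"
    proof (rule ccontr)
      assume "\<not> snd x > 0"
      then have "snd x = 0" using that by simp
      then have "inner (fst x) (fst x) = e" using that by simp
      then have "inner (fst x) (fst x) = -1" using False eps by simp
      then show False using inner_ge_zero[of "fst x"] by linarith
    qed
    then show ?thesis
      unfolding space_form_def qform_def using False eps by (auto simp: less_imp_le)
  qed
  moreover have "closed \<dots>"
    by (intro closed_Int closed_Collect_eq closed_Collect_le continuous_intros)
  ultimately show ?thesis by simp
qed

lemma q_range:
  assumes "x \<in> X"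
  shows "eps = 1 \<Longrightarrow> \<bar>q p x\<bar> \<le> 1" "eps = -1 \<Longrightarrow> 1 \<le> - q p x"
proof -
  assume s: "eps = 1"
  show "\<bar>q p x\<bar> \<le> 1"
    unfolding q_sphere[OF s] using Cauchy_Schwarz_ineq2[of p x] norm_sphere[OF s] base_point assms by simp
next
  assume s: "eps = -1"
  note P = snd_hyperboloid[OF s base_point] and Y = snd_hyperboloid[OF s assms]
  have "(1 + norm (fst p) * norm (fst x))\<^sup>2 \<le> (1 + (norm (fst p))\<^sup>2) * (1 + (norm (fst x))\<^sup>2)"
  proof -
    have "0 \<le> (norm (fst p) - norm (fst x))\<^sup>2" by simp
    then show ?thesis by (simp add: power2_eq_square algebra_simps)
  qed
  also have "\<dots> = (snd p * snd x)\<^sup>2" using P(2) Y(2) by (simp add: power_mult_distrib)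
  finally have "1 + norm (fst p) * norm (fst x) \<le> snd p * snd x"
    by (rule power2_le_imp_le) (use P Y in simp)
  moreover have "inner (fst p) (fst x) \<le> norm (fst p) * norm (fst x)" by (rule norm_cauchy_schwarz)
  ultimately show "1 \<le> - q p x" using s by (simp add: qform_def)
qed

lemma d_props:
  assumes "x \<in> X"
  shows "0 \<le> d x" "cs (d x) = e * q p x" "eps = 1 \<Longrightarrow> d x \<le> pi"
proof -
  have "0 \<le> d x \<and> cs (d x) = e * q p x \<and> (eps = 1 \<longrightarrow> d x \<le> pi)"
  proof (cases "eps = 1")
    case True
    then show ?thesis
      using q_range(1)[OF assms True] arccos_lbound[of "q p x"] arccos_ubound[of "q p x"]
      unfolding cs_def geo_dist_def by auto
  next
    case False
    then have n: "eps = -1" using eps by simp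
    note r = q_range(2)[OF assms n]
    have "d x = arcosh (- q p x)" "cs (d x) = cosh (d x)"
      unfolding cs_def geo_dist_def using n by simp_all
    moreover have "cosh (arcosh (- q p x)) = - q p x" using r by (rule cosh_arcosh_real)
    moreover have "0 \<le> arcosh (- q p x)" using r by (rule arcosh_nonneg_real)
    moreover have "e = -1" using n by simp
    ultimately show ?thesis using False by simp
  qed
  then show "0 \<le> d x" "cs (d x) = e * q p x" "eps = 1 \<Longrightarrow> d x \<le> pi" by auto
qed

lemma cs_inj:
  assumes "0 \<le> s" "0 \<le> t" "eps = 1 \<Longrightarrow> s \<le> pi \<and> t \<le> pi" "cs s = cs t"
  shows "s = t"
proof (cases "eps = 1")
  case True
  then show ?thesis using assms cos_inj_pi[of s t] unfolding cs_def by simp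
next
  case False
  then show ?thesis
    using assms arcosh_cosh_real[of s] arcosh_cosh_real[of t] unfolding cs_def by simp
qed

lemma d_eqI:
  assumes "x \<in> X" "0 \<le> t" "eps = 1 \<Longrightarrow> t \<le> pi" "q p x = e * cs t"
  shows "d x = t"
proof (rule cs_inj)
  have "e * q p x = cs t" using assms(4) e_sq by (simp flip: mult.assoc)
  then show "cs (d x) = cs t" using d_props(2)[OF assms(1)] by simp
qed (use d_props[OF assms(1)] assms in auto)

lemma d_base [simp]: "d p = 0"
  by (rule d_eqI[OF base_point]) (use q_self[OF base_point] pi_ge_zero in auto)

lemma continuous_on_d: "continuous_on X d"
proof -
  have q: "continuous_on X (q p)"
    unfolding qform_def[abs_def] by (intro continuous_intros)
  show ?thesis
  proof (cases "eps = 1")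
    case True
    have "\<forall>x\<in>X. - 1 \<le> q p x \<and> q p x \<le> 1"
      using q_range(1)[OF _ True] by (simp add: abs_le_iff minus_le_iff)
    then have "continuous_on X (\<lambda>x. arccos (q p x))"
      by (rule continuous_on_arccos[OF q])
    then show ?thesis unfolding geo_dist_def[abs_def] using True by simp
  next
    case False
    then have n: "eps = -1" using eps by simp
    have "continuous_on X (\<lambda>x. arcosh (- q p x))"
    proof (rule continuous_on_compose2[OF continuous_on_arcosh[OF order.refl] continuous_on_minus[OF q]])
      show "(\<lambda>x. - q p x) ` X \<subseteq> {1..}" using q_range(2)[OF _ n] by force
    qed
    then show ?thesis unfolding geo_dist_def[abs_def] using n by simp
  qed
qed

text \<open>
  Membership in the upper sheet of the hyperboloid: two timelike vectors in opposite cones have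
  nonnegative product.
\<close>

lemma snd_pos_if_future:
  assumes n: "eps = -1" and y: "q y y = e" and neg: "q p y < 0"
  shows "snd y > 0"
proof (rule ccontr)
  assume "\<not> snd y > 0"
  then have le: "snd y \<le> 0" by simp
  have "(norm (fst y))\<^sup>2 \<le> (- snd y)\<^sup>2"
    using y n by (simp add: qform_def power2_norm_eq_inner power2_eq_square[of "snd y"])
  then have "norm (fst y) \<le> - snd y" by (rule power2_le_imp_le) (use le in simp)
  then have "norm (fst p) * norm (fst y) \<le> snd p * (- snd y)"
    using norm_fst_less_snd[OF n base_point] snd_hyperboloid[OF n base_point]
    by (intro mult_mono) auto
  moreover have "- inner (fst p) (fst y) \<le> norm (fst p) * norm (fst y)"
    using Cauchy_Schwarz_ineq2[of "fst p" "fst y"] by linarith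
  ultimately show False using neg n by (simp add: qform_def)
qed

lemma geodesic_in_X:
  assumes v: "q p v = 0" "q v v = 1" and t: "0 \<le> t" "eps = 1 \<Longrightarrow> t \<le> pi"
  shows "cs t *\<^sub>R p + sn t *\<^sub>R v \<in> X" "d (cs t *\<^sub>R p + sn t *\<^sub>R v) = t"
proof -
  let ?y = "cs t *\<^sub>R p + sn t *\<^sub>R v"
  have vp: "q v p = 0" using v by (simp add: q_commute)
  have py: "q p ?y = e * cs t" by (simp add: q_linear v q_self[OF base_point])
  have "q ?y ?y = e * (cs t)\<^sup>2 + (sn t)\<^sup>2"
    by (simp add: q_linear v vp q_self[OF base_point] power2_eq_square)
  also have "\<dots> = e * ((cs t)\<^sup>2 + e * (sn t)\<^sup>2)"
    using e_sq by (simp add: distrib_left flip: mult.assoc)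
  finally have yy: "q ?y ?y = e" by (simp only: pythagoras mult_1_right)
  have "snd ?y > 0" if n: "eps = -1"
  proof (rule snd_pos_if_future[OF n yy])
    have "0 < cs t" unfolding cs_def using n by simp
    then show "q p ?y < 0" unfolding py using n by simp
  qed
  then show y: "?y \<in> X" unfolding space_form_def using yy by simp
  show "d ?y = t" by (rule d_eqI[OF y t py])
qed

text \<open>
  Polar coordinates around \<open>p\<close>: \<open>v\<close> is the unit tangent vector at \<open>p\<close> pointing to \<open>x\<close>.
\<close>

lemma direction_exists:
  assumes x: "x \<in> X" and s: "sn (d x) \<noteq> 0"
  shows "\<exists>v. q p v = 0 \<and> q v v = 1 \<and> x = cs (d x) *\<^sub>R p + sn (d x) *\<^sub>R v"
proof -
  let ?s = "d x"
  define v where "v = (1 / sn ?s) *\<^sub>R x + (- cs ?s / sn ?s) *\<^sub>R p"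
  have px: "q p x = e * cs ?s" using d_props(2)[OF x] e_sq by (simp flip: mult.assoc)
  have "q p v = 0"
    unfolding v_def q_linear px q_self[OF base_point] by simp
  moreover have "q v v = 1"
  proof -
    have "q v v = (q x x - 2 * cs ?s * q p x + (cs ?s)\<^sup>2 * q p p) / (sn ?s)\<^sup>2"
      unfolding v_def q_linear q_commute[of x p] using s
      by (simp add: field_simps power2_eq_square)
    also have "\<dots> = e * (1 - (cs ?s)\<^sup>2) / (sn ?s)\<^sup>2"
      by (simp add: q_self[OF base_point] q_self[OF x] px algebra_simps power2_eq_square)
    also have "1 - (cs ?s)\<^sup>2 = e * (sn ?s)\<^sup>2" using pythagoras[of ?s] by simp
    finally show ?thesis using s e_sq by (simp flip: mult.assoc)
  qed
  moreover have "x = cs ?s *\<^sub>R p + sn ?s *\<^sub>R v"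
    unfolding v_def scaleR_right_distrib scaleR_scaleR using s by simp
  ultimately show ?thesis by blast
qed

text \<open>
  Geodesic balls are bounded for the ambient norm.  In the hyperbolic case the vector \<open>p\<close> is
  timelike, \<open>norm (fst p) < snd p\<close>, so \<open>- q p x = cosh (d x)\<close> controls \<open>snd x\<close> and thereby \<open>x\<close>.
\<close>

lemma bounded_ball: "bounded {x \<in> X. d x \<le> r}"
proof (cases "eps = 1")
  case True
  then have "\<forall>x\<in>{x \<in> X. d x \<le> r}. norm x \<le> 1" using norm_sphere by auto
  then show ?thesis unfolding bounded_iff by blast
next
  case False
  then have n: "eps = -1" using eps by simp
  let ?k = "snd p - norm (fst p)"
  have k: "?k > 0" using norm_fst_less_snd[OF n base_point] by simp
  have "norm x \<le> 2 * (cosh (\<bar>r\<bar>) / ?k)" if x: "x \<in> X" "d x \<le> r" for x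
  proof -
    note Y = snd_hyperboloid[OF n x(1)] norm_fst_less_snd[OF n x(1)]
    have "inner (fst p) (fst x) \<le> norm (fst p) * norm (fst x)" by (rule norm_cauchy_schwarz)
    also have "\<dots> \<le> norm (fst p) * snd x" using Y by (intro mult_left_mono) auto
    finally have "snd x * ?k \<le> - q p x" by (simp add: qform_def n algebra_simps)
    also have "\<dots> = cosh (d x)" using d_props(2)[OF x(1)] n unfolding cs_def by simp
    also have "\<dots> \<le> cosh \<bar>r\<bar>"
      using d_props(1)[OF x(1)] x(2) by (intro cosh_real_nonneg_le_iff[THEN iffD2]) auto
    finally have "snd x \<le> cosh \<bar>r\<bar> / ?k" using k by (simp add: pos_le_divide_eq)
    moreover have "norm x \<le> norm (fst x) + norm (snd x)"
      using norm_Pair_le[of "fst x" "snd x"] by simp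
    ultimately show ?thesis using Y by simp
  qed
  then show ?thesis unfolding bounded_iff by blast
qed

end

section \<open>The region enclosed by a sphere\<close>

text \<open>
  A component of the complement cannot meet both of two disjoint open parts covering it, so the
  components through points of \<open>A\<close> stay in the bounded set \<open>A\<close>.
\<close>

lemma enclosed_region_eq:
  fixes M S A B :: "'a::metric_space set"
  assumes split: "M - S = A \<union> B" "A \<inter> B = {}"
    and op: "openin (top_of_set (M - S)) A" "openin (top_of_set (M - S)) B"
    and bdd: "bounded A"
    and unbdd: "\<And>q. q \<in> B \<Longrightarrow> \<exists>C. connected C \<and> q \<in> C \<and> C \<subseteq> M - S \<and> \<not> bounded C"
  shows "enclosed_region M S = S \<union> A"
proof -
  have A: "bounded (connected_component_set (M - S) q)" if q: "q \<in> A" for q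
  proof -
    let ?K = "connected_component_set (M - S) q"
    have K: "?K \<subseteq> M - S" by (rule connected_component_subset)
    have qK: "q \<in> ?K" using q split by (simp add: connected_component_refl)
    have "(M - S) \<inter> A = A" "(M - S) \<inter> B = B" using split(1) by auto
    then have 1: "openin (top_of_set ?K) (?K \<inter> A)" "openin (top_of_set ?K) (?K \<inter> B)"
      using openin_subtopology_Int_subset[OF _ K] op by simp_all
    have "?K \<subseteq> A"
    proof (rule ccontr)
      assume "\<not> ?K \<subseteq> A"
      then have "?K \<inter> B \<noteq> {}" using K split(1) by blast
      moreover have "?K \<inter> A \<noteq> {}" using q qK by blast
      moreover have "?K \<subseteq> (?K \<inter> A) \<union> (?K \<inter> B)" using K split(1) by blast
      moreover have "(?K \<inter> A) \<inter> (?K \<inter> B) = {}" using split(2) by blast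
      ultimately have "\<not> connected ?K"
        unfolding connected_openin using 1 by (metis (no_types, lifting))
      then show False by simp
    qed
    then show ?thesis using bdd bounded_subset by blast
  qed
  have B: "\<not> bounded (connected_component_set (M - S) q)" if q: "q \<in> B" for q
  proof -
    obtain C where C: "connected C" "q \<in> C" "C \<subseteq> M - S" "\<not> bounded C" using unbdd[OF q] by blast
    then have "C \<subseteq> connected_component_set (M - S) q" by (intro connected_component_maximal)
    then show ?thesis using C(4) bounded_subset by blast
  qed
  have "{z \<in> M - S. bounded (connected_component_set (M - S) z)} = A"
  proof (intro equalityI subsetI)
    fix z assume z: "z \<in> {z \<in> M - S. bounded (connected_component_set (M - S) z)}"
    then have "z \<in> A \<union> B" using split(1) by simp
    then show "z \<in> A" using z B[of z] by auto
  next
    fix z assume "z \<in> A"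
    then show "z \<in> {z \<in> M - S. bounded (connected_component_set (M - S) z)}"
      using A[of z] split(1) by auto
  qed
  then show ?thesis unfolding enclosed_region_def by simp
qed

lemma unbounded_ray_fibre:
  fixes x :: "'a::real_normed_vector" and t :: real
  shows "\<not> bounded ({x} \<times> {t..})" "\<not> bounded ({x} \<times> {..t})"
proof -
  have "\<not> bdd_above {t..}"
    unfolding bdd_above_def
  proof
    assume "\<exists>M. \<forall>y\<in>{t..}. y \<le> M"
    then obtain M where "\<And>y. t \<le> y \<Longrightarrow> y \<le> M" by auto
    from this[of "max t M + 1"] show False by linarith
  qed
  then show "\<not> bounded ({x} \<times> {t..})"
    using bounded_snd[of "{x} \<times> {t..}"] bounded_imp_bdd_above[of "{t..}"] by auto
  have "\<not> bdd_below {..t}"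
    unfolding bdd_below_def
  proof
    assume "\<exists>M. \<forall>y\<in>{..t}. M \<le> y"
    then obtain M where "\<And>y. y \<le> t \<Longrightarrow> M \<le> y" by auto
    from this[of "min t M - 1"] show False by linarith
  qed
  then show "\<not> bounded ({x} \<times> {..t})"
    using bounded_snd[of "{x} \<times> {..t}"] bounded_imp_bdd_below[of "{..t}"] by auto
qed

context pointed_space_form begin

abbreviation radius_of :: "real \<Rightarrow> real" where "radius_of H \<equiv> radius (Suc m) eps H"
abbreviation height_of :: "real \<Rightarrow> real" where "height_of H \<equiv> sym_height (Suc m) eps H"
abbreviation mer :: "real \<Rightarrow> real \<Rightarrow> real" where "mer H s \<equiv> meridian (Suc m) eps H s"
abbreviation slope :: "real \<Rightarrow> real \<Rightarrow> real" where
  "slope H u \<equiv> H * phi u / sqrt (1 - H\<^sup>2 * (phi u)\<^sup>2)"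

lemma meridian_props:
  assumes H: "H > C_eps (Suc m) eps"
  shows "continuous_on {0..radius_of H} (mer H)" "mer H 0 = 0" "mer H (radius_of H) = height_of H"
    and "\<And>s t. 0 \<le> s \<Longrightarrow> s \<le> t \<Longrightarrow> t \<le> radius_of H \<Longrightarrow> mer H s \<le> mer H t"
    and "\<And>s. s \<le> radius_of H \<Longrightarrow> slope H integrable_on {0..s}"
proof -
  have int: "slope H integrable_on {0..radius_of H}" using slope_has_integral[OF H] by blast
  show int': "slope H integrable_on {0..s}" if "s \<le> radius_of H" for s
    by (rule integrable_on_subinterval[OF int]) (use that in auto)
  show "continuous_on {0..radius_of H} (mer H)"
    unfolding meridian_def[abs_def] by (rule indefinite_integral_continuous_1[OF int])
  show "mer H 0 = 0" by (simp add: meridian_def)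
  show "mer H (radius_of H) = height_of H" by (simp add: sym_height_def)
  fix s t assume st: "0 \<le> s" "s \<le> t" "t \<le> radius_of H"
  have rad: "radius_of H \<in> radii" "phi (radius_of H) = 1 / H" using radius_props[OF H] by auto
  have H0: "0 < H" using H C_eps_nonneg by simp
  have nn: "0 \<le> slope H u" if u: "u \<in> {0..t}" for u
  proof -
    have "u \<in> {0..radius_of H}" using u st by simp
    then have "phi u \<in> {0..1 / H}" using phi_image[OF rad(1)] unfolding rad(2) by blast
    then have "0 \<le> H * phi u" "H * phi u \<le> 1" using H0 by (auto simp: field_simps)
    then have "(H * phi u)\<^sup>2 \<le> 1" by (simp add: power_le_one)
    then show ?thesis using \<open>0 \<le> H * phi u\<close> by (simp add: power_mult_distrib)
  qed
  show "mer H s \<le> mer H t"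
    unfolding meridian_def
  proof (rule integral_subset_le)
    show "{0..s} \<subseteq> {0..t}" using st by simp
    show "slope H integrable_on {0..s}" "slope H integrable_on {0..t}"
      using st by (auto intro: int')
  qed (use nn in blast)
qed

text \<open>
  The slopes are ordered in \<open>H\<close> except at the endpoint \<open>s = radius_of H\<close>, where division by zero
  gives the steeper slope the value \<open>0\<close>; changing that one value does not affect the integral.
\<close>

lemma meridian_mono_H:
  assumes "C_eps (Suc m) eps < H'" "H' < H" and s: "0 \<le> s" "s \<le> radius_of H"
  shows "mer H' s \<le> mer H s"
proof -
  have C: "C_eps (Suc m) eps < H" "0 < H'" using assms C_eps_nonneg by linarith+
  have rad: "radius_of H \<in> radii" "phi (radius_of H) = 1 / H" using radius_props[OF C(1)] by auto
  have rr: "radius_of H \<le> radius_of H'" using assms by (intro radius_antimono)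
  let ?k = "\<lambda>u. if u = radius_of H then slope H' u else slope H u"
  have int: "slope H integrable_on {0..s}" "slope H' integrable_on {0..s}"
    using meridian_props(5)[OF C(1) s(2)] meridian_props(5)[OF assms(1), of s] s rr by auto
  have k: "?k integrable_on {0..s}"
    by (rule integrable_spike[OF int(1), of "{radius_of H}"]) auto
  have "integral {0..s} (slope H') \<le> integral {0..s} ?k"
  proof (rule integral_le[OF int(2) k])
    fix u assume u: "u \<in> {0..s}"
    show "slope H' u \<le> ?k u"
    proof (cases "u = radius_of H")
      case False
      then have "phi u < phi (radius_of H)" using u s rad by (intro phi_strict_mono) auto
      then have lt: "H * phi u < 1" using rad(2) C assms(2) by (simp add: field_simps)
      have "u \<in> {0..radius_of H}" using u s by simp
      then have "phi u \<in> {0..1 / H}" using phi_image[OF rad(1)] unfolding rad(2) by blast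
      then have p: "0 \<le> phi u" by simp
      have le: "H' * phi u \<le> H * phi u" using p assms by (intro mult_right_mono) auto
      have nn: "0 \<le> H' * phi u" using p C by simp
      have "(H' * phi u)\<^sup>2 \<le> (H * phi u)\<^sup>2" using le nn by (rule power_mono)
      moreover have "(H * phi u)\<^sup>2 < 1" using lt le nn by (simp add: power_less_one_iff abs_square_less_1)
      ultimately have "sqrt (1 - H\<^sup>2 * (phi u)\<^sup>2) \<le> sqrt (1 - H'\<^sup>2 * (phi u)\<^sup>2)"
        "0 < sqrt (1 - H\<^sup>2 * (phi u)\<^sup>2)"
        by (auto simp: power_mult_distrib)
      then have "slope H' u \<le> slope H u" using le nn by (intro frac_le) auto
      then show ?thesis using False by simp
    qed simp
  qed
  also have "\<dots> = integral {0..s} (slope H)"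
    by (rule integral_spike[of "{radius_of H}"]) auto
  finally show ?thesis by (simp add: meridian_def)
qed

lemma meridian_range:
  assumes "H > C_eps (Suc m) eps" "x \<in> X" "d x \<le> radius_of H"
  shows "0 \<le> mer H (d x)" "mer H (d x) \<le> height_of H"
  using meridian_props(4)[OF assms(1), of 0 "d x"] meridian_props(4)[OF assms(1), of "d x" "radius_of H"]
    meridian_props(2,3)[OF assms(1)] d_props(1)[OF assms(2)] assms(3) by auto

lemma radius_in_range:
  assumes "H > C_eps (Suc m) eps"
  shows "0 < radius_of H" "eps = 1 \<Longrightarrow> radius_of H < pi"
  using radius_props(1)[OF assms] unfolding radii_iff by blast+

text \<open>
  The meridian continued by its final height beyond the radius, so that it is defined and
  continuous on the whole space form.
\<close>

definition capped :: "real \<Rightarrow> (real ^ 'n) \<times> real \<Rightarrow> real" where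
  "capped H x = mer H (min (d x) (radius_of H))"

lemma continuous_on_d_fst: "continuous_on (X \<times> (UNIV :: real set)) (\<lambda>z. d (fst z))"
  by (rule continuous_on_compose2[OF continuous_on_d continuous_on_fst[OF continuous_on_id]]) auto

lemma continuous_on_capped:
  assumes "H > C_eps (Suc m) eps"
  shows "continuous_on (X \<times> (UNIV :: real set)) (\<lambda>z. capped H (fst z))"
  unfolding capped_def
proof (rule continuous_on_compose2[OF meridian_props(1)[OF assms]])
  show "continuous_on (X \<times> (UNIV :: real set)) (\<lambda>z. min (d (fst z)) (radius_of H))"
    by (intro continuous_on_min continuous_on_const continuous_on_d_fst)
  show "(\<lambda>z. min (d (fst z)) (radius_of H)) ` (X \<times> (UNIV :: real set)) \<subseteq> {0..radius_of H}"
    using d_props(1) radius_in_range(1)[OF assms] by (auto simp: min_def)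
qed

text \<open>
  The closure adds exactly the equator: a point at distance equal to the radius is the end of a
  geodesic from \<open>p\<close> whose other points are in the open ball.
\<close>

lemma lower_sheet_eq:
  assumes H: "H > C_eps (Suc m) eps"
  shows "lower_sheet eps p H = {z. fst z \<in> X \<and> d (fst z) \<le> radius_of H \<and> snd z = mer H (d (fst z))}"
    (is "_ = ?L")
proof -
  let ?S = "lower_hemisphere eps p H"
  have S: "?S = {z. fst z \<in> X \<and> d (fst z) < radius_of H \<and> snd z = mer H (d (fst z))}"
    unfolding lower_hemisphere_def geo_ball_def dimension by force
  have "closure ?S \<subseteq> ?L"
  proof (rule closure_minimal)
    show "?S \<subseteq> ?L" unfolding S by auto
    have M: "closed (X \<times> (UNIV :: real set))" using closed_X by (intro closed_Times) auto
    have "?L = ((X \<times> UNIV) \<inter> (\<lambda>z. d (fst z)) -` {..radius_of H}) \<inter> ((X \<times> UNIV) \<inter> (\<lambda>z. snd z - capped H (fst z)) -` {0})"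
      unfolding capped_def by (auto simp: min_def)
    moreover have "closed \<dots>"
      by (intro closed_Int continuous_closed_preimage M continuous_on_d_fst continuous_on_diff
            continuous_on_capped[OF H] continuous_on_snd continuous_on_id) auto
    ultimately show "closed ?L" by simp
  qed
  moreover have "?L \<subseteq> closure ?S"
  proof
    fix z assume z: "z \<in> ?L"
    show "z \<in> closure ?S"
    proof (cases "d (fst z) < radius_of H")
      case True
      then have "z \<in> ?S" using z unfolding S by auto
      then show ?thesis using closure_subset by blast
    next
      case False
      then have dz: "d (fst z) = radius_of H" using z by auto
      have zX: "fst z \<in> X" using z by auto
      note R = radius_in_range[OF H]
      have "sn (d (fst z)) \<noteq> 0" using sn_pos[OF radius_props(1)[OF H]] unfolding dz by simp
      from direction_exists[OF zX this] obtain v where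
        v: "q p v = 0" "q v v = 1" "fst z = cs (radius_of H) *\<^sub>R p + sn (radius_of H) *\<^sub>R v"
        unfolding dz by blast
      let ?g = "\<lambda>t. (cs t *\<^sub>R p + sn t *\<^sub>R v, mer H t)"
      have cl: "closure {0..<radius_of H} = {0..radius_of H}" using R(1) by simp
      have "?g ` closure {0..<radius_of H} \<subseteq> closure ?S"
      proof (rule image_closure_subset)
        show "continuous_on (closure {0..<radius_of H}) ?g"
          unfolding cl by (intro continuous_intros meridian_props(1)[OF H])
        show "?g ` {0..<radius_of H} \<subseteq> closure ?S"
        proof (rule subset_trans[OF _ closure_subset], rule image_subsetI)
          fix t assume t: "t \<in> {0..<radius_of H}"
          have "eps = 1 \<Longrightarrow> t \<le> pi" using R(2) t by auto
          with geodesic_in_X[OF v(1,2), of t] t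
          have "cs t *\<^sub>R p + sn t *\<^sub>R v \<in> X" "d (cs t *\<^sub>R p + sn t *\<^sub>R v) = t" by simp_all
          then show "?g t \<in> ?S" unfolding S using t by simp
        qed
      qed simp
      moreover have "z = ?g (radius_of H)"
        using z v(3) dz by (intro prod_eqI) auto
      ultimately show ?thesis unfolding cl using R(1) by auto
    qed
  qed
  ultimately show ?thesis unfolding lower_sheet_def by blast
qed

lemma upper_sheet_eq:
  assumes H: "H > C_eps (Suc m) eps"
  shows "upper_sheet eps p H = {z. fst z \<in> X \<and> d (fst z) \<le> radius_of H \<and> snd z = 2 * height_of H - mer H (d (fst z))}"
proof (intro equalityI subsetI)
  fix z assume "z \<in> upper_sheet eps p H"
  then show "z \<in> {z. fst z \<in> X \<and> d (fst z) \<le> radius_of H \<and> snd z = 2 * height_of H - mer H (d (fst z))}"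
    unfolding upper_sheet_def lower_sheet_eq[OF H] reflect_height_def dimension by auto
next
  fix z assume z: "z \<in> {z. fst z \<in> X \<and> d (fst z) \<le> radius_of H \<and> snd z = 2 * height_of H - mer H (d (fst z))}"
  have "z = reflect_height (height_of H) (fst z, mer H (d (fst z)))"
    using z unfolding reflect_height_def by (intro prod_eqI) auto
  then show "z \<in> upper_sheet eps p H"
    unfolding upper_sheet_def lower_sheet_eq[OF H] dimension using z by (intro image_eqI) auto
qed

lemma cmc_sphere_eq:
  assumes H: "H > C_eps (Suc m) eps"
  shows "cmc_sphere eps p H =
    {z. fst z \<in> X \<and> d (fst z) \<le> radius_of H \<and> \<bar>snd z - height_of H\<bar> = height_of H - mer H (d (fst z))}"
proof -
  have "(b = a \<or> b = 2 * c - a) \<longleftrightarrow> \<bar>b - c\<bar> = c - a" if "a \<le> c" for a b c :: real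
    using that by (auto simp: abs_real_def)
  then have "(snd z = mer H (d (fst z)) \<or> snd z = 2 * height_of H - mer H (d (fst z)))
      \<longleftrightarrow> \<bar>snd z - height_of H\<bar> = height_of H - mer H (d (fst z))" if "fst z \<in> X" "d (fst z) \<le> radius_of H" for z
    using meridian_range(2)[OF H that] by blast
  then show ?thesis
    unfolding cmc_sphere_def lower_sheet_eq[OF H] upper_sheet_eq[OF H] by blast
qed

text \<open>
  The function \<open>k\<close> is the signed vertical distance to the nearer hemisphere, both hemispheres being
  extended by the capped meridian, and it is continuous.  Off the sphere it is positive exactly on
  the bounded inside; every other point has \<open>k < 0\<close> or lies outside the cylinder over the ball, and
  a vertical ray from it avoids the sphere.
\<close>

lemma Omega_eq:
  assumes H: "H > C_eps (Suc m) eps"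
  shows "Omega eps p H =
    {z. fst z \<in> X \<and> d (fst z) \<le> radius_of H \<and> \<bar>snd z - height_of H\<bar> \<le> height_of H - mer H (d (fst z))}"
proof -
  let ?M = "X \<times> (UNIV :: real set)"
  let ?S = "cmc_sphere eps p H"
  let ?k = "\<lambda>z. height_of H - capped H (fst z) - \<bar>snd z - height_of H\<bar>"
  let ?A = "(?M - ?S) \<inter> ?k -` {0<..}"
  let ?B = "((?M - ?S) \<inter> ?k -` {..<0}) \<union> ((?M - ?S) \<inter> (\<lambda>z. d (fst z)) -` {radius_of H<..})"
  have capped_in: "capped H x = mer H (d x)" if "d x \<le> radius_of H" for x
    using that by (simp add: capped_def)
  have capped_out: "capped H x = height_of H" if "radius_of H \<le> d x" for x
    using that meridian_props(3)[OF H] by (simp add: capped_def)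
  have k: "continuous_on ?M ?k"
    by (intro continuous_on_diff continuous_on_const continuous_on_rabs
         continuous_on_capped[OF H] continuous_on_snd continuous_on_id)
  have A: "?A = {z. fst z \<in> X \<and> d (fst z) < radius_of H \<and> \<bar>snd z - height_of H\<bar> < height_of H - mer H (d (fst z))}"
  proof (intro equalityI subsetI)
    fix z assume z: "z \<in> ?A"
    then have "d (fst z) < radius_of H"
      using capped_out[of "fst z"] by (cases "d (fst z) < radius_of H") auto
    then show "z \<in> {z. fst z \<in> X \<and> d (fst z) < radius_of H \<and> \<bar>snd z - height_of H\<bar> < height_of H - mer H (d (fst z))}"
      using z capped_in[of "fst z"] by auto
  next
    fix z assume z: "z \<in> {z. fst z \<in> X \<and> d (fst z) < radius_of H \<and> \<bar>snd z - height_of H\<bar> < height_of H - mer H (d (fst z))}"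
    then show "z \<in> ?A"
      using capped_in[of "fst z"] unfolding cmc_sphere_eq[OF H] by (auto simp: mem_Times_iff)
  qed
  have "enclosed_region ?M ?S = ?S \<union> ?A"
  proof (rule enclosed_region_eq[where B = ?B])
    show "?M - ?S = ?A \<union> ?B"
    proof (intro equalityI subsetI)
      fix z assume z: "z \<in> ?M - ?S"
      show "z \<in> ?A \<union> ?B"
      proof (cases "d (fst z) \<le> radius_of H")
        case True
        then have "?k z \<noteq> 0"
          using z capped_in[OF True] unfolding cmc_sphere_eq[OF H] by auto
        then show ?thesis using z by auto
      qed (use z in auto)
    qed auto
    show "?A \<inter> ?B = {}"
      unfolding A using capped_in by auto
    have k': "continuous_on (?M - ?S) ?k" by (rule continuous_on_subset[OF k]) auto
    have d': "continuous_on (?M - ?S) (\<lambda>z. d (fst z))"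
      by (rule continuous_on_subset[OF continuous_on_d_fst]) auto
    show "openin (top_of_set (?M - ?S)) ?A"
      by (rule continuous_openin_preimage_gen[OF k']) simp
    show "openin (top_of_set (?M - ?S)) ?B"
      by (intro openin_Un continuous_openin_preimage_gen[OF k'] continuous_openin_preimage_gen[OF d']) simp_all
    have "?A \<subseteq> {x \<in> X. d x \<le> radius_of H} \<times> {height_of H - \<bar>height_of H\<bar> - height_of H .. 3 * \<bar>height_of H\<bar>}"
      unfolding A using meridian_range[OF H] by (force simp: mem_Times_iff)
    then show "bounded ?A"
      by (rule bounded_subset[OF bounded_Times[OF bounded_ball bounded_closed_interval]])
    fix z assume z: "z \<in> ?B"
    have zM: "fst z \<in> X" "z \<notin> ?S" using z by auto
    show "\<exists>C. connected C \<and> z \<in> C \<and> C \<subseteq> ?M - ?S \<and> \<not> bounded C"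
    proof (cases "snd z \<ge> height_of H")
      case True
      have "{fst z} \<times> {snd z..} \<subseteq> ?M - ?S"
      proof
        fix w assume w: "w \<in> {fst z} \<times> {snd z..}"
        then have "fst w = fst z" "snd w \<ge> snd z" by auto
        then show "w \<in> ?M - ?S"
          using z zM True capped_in[of "fst z"] unfolding cmc_sphere_eq[OF H] by (auto simp: mem_Times_iff)
      qed
      moreover have "connected ({fst z} \<times> {snd z..})" by (intro connected_Times) auto
      ultimately show ?thesis
        using unbounded_ray_fibre(1)[of "fst z" "snd z"]
        by (intro exI[of _ "{fst z} \<times> {snd z..}"]) (auto simp: mem_Times_iff)
    next
      case False
      have "{fst z} \<times> {..snd z} \<subseteq> ?M - ?S"
      proof
        fix w assume w: "w \<in> {fst z} \<times> {..snd z}"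
        then have "fst w = fst z" "snd w \<le> snd z" by auto
        then show "w \<in> ?M - ?S"
          using z zM False capped_in[of "fst z"] unfolding cmc_sphere_eq[OF H] by (auto simp: mem_Times_iff)
      qed
      moreover have "connected ({fst z} \<times> {..snd z})" by (intro connected_Times) auto
      ultimately show ?thesis
        using unbounded_ray_fibre(2)[of "fst z" "snd z"]
        by (intro exI[of _ "{fst z} \<times> {..snd z}"]) (auto simp: mem_Times_iff)
    qed
  qed
  moreover have "?S \<union> ?A = {z. fst z \<in> X \<and> d (fst z) \<le> radius_of H \<and> \<bar>snd z - height_of H\<bar> \<le> height_of H - mer H (d (fst z))}"
    unfolding A unfolding cmc_sphere_eq[OF H]
  proof (intro equalityI subsetI)
    fix z assume z: "z \<in> {z. fst z \<in> X \<and> d (fst z) \<le> radius_of H \<and> \<bar>snd z - height_of H\<bar> \<le> height_of H - mer H (d (fst z))}"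
    then have "d (fst z) < radius_of H" if "\<bar>snd z - height_of H\<bar> < height_of H - mer H (d (fst z))"
      using that meridian_props(3)[OF H] by (cases "d (fst z) = radius_of H") auto
    then show "z \<in> {z. fst z \<in> X \<and> d (fst z) \<le> radius_of H \<and> \<bar>snd z - height_of H\<bar> = height_of H - mer H (d (fst z))} \<union>
        {z. fst z \<in> X \<and> d (fst z) < radius_of H \<and> \<bar>snd z - height_of H\<bar> < height_of H - mer H (d (fst z))}"
      using z by auto
  qed auto
  ultimately show ?thesis unfolding Omega_def by simp
qed

text \<open>
  If the inclusion holds, the highest point \<open>(p, 2 h(H))\<close> lies in the larger region, which gives
  the inequality.  Conversely the lower hemispheres are ordered by \<open>meridian_mono_H\<close>, and together
  with \<open>h(H) \<le> h(H')\<close> this orders the upper ones, which are at \<open>2 h\<close> minus the meridian.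
\<close>

lemma Omega_subset_iff:
  assumes "C_eps (Suc m) eps < H'" "H' < H"
  shows "Omega eps p H \<subseteq> Omega eps p H' \<longleftrightarrow> height_of H \<le> height_of H'"
proof -
  have H: "C_eps (Suc m) eps < H" using assms by simp
  have h: "0 \<le> height_of H" "0 \<le> height_of H'"
    using meridian_range[OF H base_point] meridian_range[OF assms(1) base_point]
      radius_in_range(1)[OF H] radius_in_range(1)[OF assms(1)] by auto
  have "height_of H \<le> height_of H'" if sub: "Omega eps p H \<subseteq> Omega eps p H'"
  proof -
    have "(p, 2 * height_of H) \<in> Omega eps p H"
      unfolding Omega_eq[OF H]
      using base_point radius_in_range(1)[OF H] meridian_props(2)[OF H] h by simp
    then have "(p, 2 * height_of H) \<in> Omega eps p H'" using sub by blast
    then show ?thesis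
      unfolding Omega_eq[OF assms(1)] using meridian_props(2)[OF assms(1)] by (simp add: abs_le_iff)
  qed
  moreover have "Omega eps p H \<subseteq> Omega eps p H'" if le: "height_of H \<le> height_of H'"
  proof
    fix z assume "z \<in> Omega eps p H"
    then have z: "fst z \<in> X" "d (fst z) \<le> radius_of H" "\<bar>snd z - height_of H\<bar> \<le> height_of H - mer H (d (fst z))"
      unfolding Omega_eq[OF H] by auto
    have "mer H' (d (fst z)) \<le> mer H (d (fst z))"
      using d_props(1)[OF z(1)] z(2) by (intro meridian_mono_H[OF assms])
    moreover have "d (fst z) \<le> radius_of H'" using z(2) radius_antimono[OF assms(2,1)] by simp
    ultimately show "z \<in> Omega eps p H'"
      unfolding Omega_eq[OF assms(1)] using z le by (auto simp: abs_le_iff)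
  qed
  ultimately show ?thesis by blast
qed

lemma nested_iff:
  assumes "C_eps (Suc m) eps \<le> C"
  shows "nested eps p C \<longleftrightarrow> (\<forall>H H'. C < H' \<and> H' < H \<longrightarrow> height_of H \<le> height_of H')"
  unfolding nested_def using Omega_subset_iff assms by (meson le_less_trans)

lemma hyperbolic_nested:
  assumes "eps = -1"
  shows "nested eps p (C_eps (Suc m) eps)"
  unfolding nested_iff[OF order.refl]
proof (intro allI impI)
  fix H H' assume H: "C_eps (Suc m) eps < H' \<and> H' < H"
  then have "radius_of H' \<in> inner_range"
    unfolding inner_range_def using radius_in_range(1)[of H'] assms by simp
  then show "height_of H \<le> height_of H'" using H by (intro height_antimono_inner) auto
qed

end

section \<open>Convergence to the horizontal slice and the threshold\<close>

lemma abs_cos_diff_le: "\<bar>cos a - cos b\<bar> \<le> \<bar>a - b\<bar>" for a b :: real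
proof -
  have "\<bar>cos a - cos b\<bar> = 2 * (\<bar>sin ((a + b) / 2)\<bar> * \<bar>sin ((b - a) / 2)\<bar>)"
    by (simp add: cos_diff_cos abs_mult)
  also have "\<dots> \<le> 2 * (1 * \<bar>(b - a) / 2\<bar>)"
    by (intro mult_left_mono mult_mono abs_sin_x_le_abs_x) auto
  finally show ?thesis by simp
qed

lemma abs_sin_diff_le: "\<bar>sin a - sin b\<bar> \<le> \<bar>a - b\<bar>" for a b :: real
proof -
  have "\<bar>sin a - sin b\<bar> = 2 * (\<bar>sin ((a - b) / 2)\<bar> * \<bar>cos ((a + b) / 2)\<bar>)"
    by (simp add: sin_diff_sin abs_mult)
  also have "\<dots> \<le> 2 * (\<bar>(a - b) / 2\<bar> * 1)"
    by (intro mult_left_mono mult_mono abs_sin_x_le_abs_x) auto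
  finally show ?thesis by simp
qed

locale pointed_sphere = pointed_space_form eps m p + spherical_profile eps m
  for eps m and p :: "(real ^ 'n::finite) \<times> real"
begin

lemma C_eps_sphere [simp]: "C_eps (Suc m) eps = 0"
  using spherical by (simp add: C_eps_def)

text \<open>
  The thresholds \<open>C\<close> beyond which the height is nonincreasing form a set \<open>A\<close> that is closed upwards
  and contains its infimum, since the condition only concerns parameters strictly above \<open>C\<close>.
\<close>

lemma nested_threshold: "\<exists>Cmin>0. \<forall>C\<ge>0. nested eps p C \<longleftrightarrow> C \<ge> Cmin"
proof -
  define A where "A = {C. 0 \<le> C \<and> (\<forall>H H'. C < H' \<and> H' < H \<longrightarrow> height_of H \<le> height_of H')}"
  obtain K where "K \<in> A"
    using height_antimono_large unfolding A_def by blast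
  then have ne: "A \<noteq> {}" by blast
  have bdd: "bdd_below A" unfolding A_def by (intro bdd_belowI[of _ 0]) simp
  obtain \<eta> where \<eta>: "\<eta> > 0" "strict_mono_on {0<..<\<eta>} height_of"
    using height_eventually_increasing by blast
  have lower: "\<eta> \<le> C" if C: "C \<in> A" for C
  proof (rule ccontr)
    assume "\<not> \<eta> \<le> C"
    then have lt: "C < \<eta>" by simp
    define H' where "H' = (2 * C + \<eta>) / 3"
    define H where "H = (C + 2 * \<eta>) / 3"
    have "0 \<le> C" using C by (simp add: A_def)
    then have o: "C < H'" "H' < H" "0 < H'" "H < \<eta>" using lt by (simp_all add: H_def H'_def)
    then have "height_of H' < height_of H" by (intro strict_mono_onD[OF \<eta>(2)]) auto
    moreover have "height_of H \<le> height_of H'" using C o unfolding A_def by blast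
    ultimately show False by simp
  qed
  then have "\<eta> \<le> Inf A" by (rule cInf_greatest[OF ne])
  moreover have "nested eps p C \<longleftrightarrow> C \<ge> Inf A" if C: "C \<ge> 0" for C
  proof -
    have "nested eps p C \<longleftrightarrow> C \<in> A"
      unfolding A_def using nested_iff[of C] C by simp
    also have "\<dots> \<longleftrightarrow> C \<ge> Inf A"
    proof
      show "C \<ge> Inf A" if "C \<in> A" using that bdd by (rule cInf_lower)
      assume le: "C \<ge> Inf A"
      have "height_of H \<le> height_of H'" if H: "C < H'" "H' < H" for H H'
      proof -
        have "Inf A < H'" using le H by simp
        then obtain a where "a \<in> A" "a < H'" using cInf_less_iff[OF ne bdd] by blast
        then show ?thesis using H unfolding A_def by blast
      qed
      then show "C \<in> A" unfolding A_def using C by blast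
    qed
    finally show ?thesis .
  qed
  ultimately show ?thesis using \<eta>(1) by (intro exI[of _ "Inf A"]) auto
qed

text \<open>
  Unlike in \<open>direction_exists\<close>, \<open>x\<close> may be antipodal to \<open>p\<close>; then every direction leads to \<open>x\<close>, and
  one exists because the ambient dimension is at least \<open>2\<close>.
\<close>

lemma direction_exists_sphere:
  assumes x: "x \<in> X" and d0: "d x \<noteq> 0"
  shows "\<exists>v. q p v = 0 \<and> q v v = 1 \<and> x = cs (d x) *\<^sub>R p + sn (d x) *\<^sub>R v"
proof (cases "d x = pi")
  case False
  have "d x \<in> radii"
    unfolding radii_iff using d_props(1,3)[OF x] d0 False spherical by auto
  then show ?thesis using direction_exists[OF x] sn_pos by fastforce
next
  case True
  have p1: "norm p = 1" "norm x = 1" using norm_sphere spherical base_point x by auto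
  have csn: "cs pi = -1" "sn pi = 0" unfolding cs_def sin_eps_def using spherical by simp_all
  then have "q p x = -1" using d_props(2)[OF x] True spherical by simp
  then have "inner p x = -1" using q_sphere[OF spherical] by simp
  then have "(norm (x + p))\<^sup>2 = 0"
    using p1 by (simp add: power2_norm_eq_inner inner_add_left inner_add_right inner_commute norm_eq_1)
  then have xp: "x = - p" by (simp add: eq_neg_iff_add_eq_0)
  have "2 \<le> DIM((real ^ 'n) \<times> real)" using m dimension by simp
  then obtain y where y: "y \<noteq> 0" "orthogonal p y" by (rule orthogonal_to_vector_exists)
  define v where "v = (1 / norm y) *\<^sub>R y"
  have "q p v = 0" "q v v = 1"
    unfolding v_def using y
    by (simp_all add: q_sphere[OF spherical] orthogonal_def dot_square_norm power2_eq_square)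
  moreover have "x = cs (d x) *\<^sub>R p + sn (d x) *\<^sub>R v"
    unfolding True csn using xp by simp
  ultimately show ?thesis by blast
qed

text \<open>
  Move from \<open>x\<close> along the geodesic towards \<open>p\<close> until the ball is reached; the chordal distance
  covered is at most twice the geodesic one.
\<close>

lemma near_point_in_ball:
  assumes x: "x \<in> X" and r: "0 < r" "r \<le> pi"
  shows "\<exists>y\<in>X. d y \<le> r \<and> dist x y \<le> 2 * (pi - r)"
proof (cases "d x \<le> r")
  case True
  then show ?thesis using x r by (intro bexI[of _ x]) auto
next
  case False
  then have "d x \<noteq> 0" using r by simp
  from direction_exists_sphere[OF x this] obtain v where
    v: "q p v = 0" "q v v = 1" "x = cs (d x) *\<^sub>R p + sn (d x) *\<^sub>R v" by blast
  define y where "y = cs r *\<^sub>R p + sn r *\<^sub>R v"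
  have y: "y \<in> X" "d y = r" unfolding y_def using geodesic_in_X[OF v(1,2), of r] r by simp_all
  have n: "norm p = 1" "norm v = 1"
    using norm_sphere[OF spherical base_point] v(2) q_sphere[OF spherical] by (simp_all add: norm_eq_1)
  have "x - y = (cs (d x) - cs r) *\<^sub>R p + (sn (d x) - sn r) *\<^sub>R v"
    unfolding y_def by (subst v(3)) (simp add: algebra_simps)
  then have "dist x y \<le> \<bar>cs (d x) - cs r\<bar> + \<bar>sn (d x) - sn r\<bar>"
    using norm_triangle_ineq[of "(cs (d x) - cs r) *\<^sub>R p" "(sn (d x) - sn r) *\<^sub>R v"] n
    by (simp add: dist_norm)
  also have "\<dots> \<le> \<bar>d x - r\<bar> + \<bar>d x - r\<bar>"
    unfolding cs_def sin_eps_def if_P[OF spherical]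
    by (rule add_mono[OF abs_cos_diff_le abs_sin_diff_le])
  also have "\<dots> \<le> 2 * (pi - r)" using False d_props(3)[OF x spherical] by simp
  finally show ?thesis using y by (intro bexI[of _ y]) auto
qed

text \<open>
  Common to both sheets: graphs over balls whose radii tend to \<open>\<pi>\<close>, with heights between \<open>0\<close> and
  twice the height of the plane of symmetry.
\<close>

lemma converges_to_slice:
  assumes S: "\<And>H. H > 0 \<Longrightarrow> S H = {z. fst z \<in> X \<and> d (fst z) \<le> radius_of H \<and> snd z = g H (fst z)}"
    and g: "\<And>H x. H > 0 \<Longrightarrow> x \<in> X \<Longrightarrow> d x \<le> radius_of H \<Longrightarrow> 0 \<le> g H x \<and> g H x \<le> 2 * height_of H"
  shows "converges_uniformly S (X \<times> {0}) (at_right 0)"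
  unfolding converges_uniformly_def
proof (intro allI impI)
  fix \<epsilon> :: real assume \<epsilon>: "\<epsilon> > 0"
  have ev1: "\<forall>\<^sub>F H in at_right 0. height_of H < \<epsilon> / 4"
    by (rule order_tendstoD(2)[OF height_tendsto_zero]) (use \<epsilon> in simp)
  have ev2: "\<forall>\<^sub>F H in at_right 0. pi - \<epsilon> / 8 \<le> radius_of H"
    by (rule radius_tendsto_pi) (use \<epsilon> in simp)
  have ev3: "\<forall>\<^sub>F H in at_right (0::real). 0 < H"
    by (rule eventually_at_right_less)
  show "\<forall>\<^sub>F H in at_right 0. (\<forall>a\<in>S H. \<exists>b\<in>X \<times> {0}. dist a b < \<epsilon>) \<and> (\<forall>b\<in>X \<times> {0}. \<exists>a\<in>S H. dist a b < \<epsilon>)"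
    using ev1 ev2 ev3
  proof eventually_elim
    case (elim H)
    have H: "C_eps (Suc m) eps < H" using elim by simp
    have R: "0 < radius_of H" "radius_of H \<le> pi" using radius_in_range[OF H] spherical by auto
    have bound: "\<bar>g H x\<bar> < \<epsilon> / 2" if "x \<in> X" "d x \<le> radius_of H" for x
      using g[OF elim(3) that] elim(1) by simp
    show ?case
    proof (intro conjI ballI)
      fix a assume "a \<in> S H"
      then have a: "fst a \<in> X" "d (fst a) \<le> radius_of H" "snd a = g H (fst a)" using S elim by auto
      have "dist a (fst a, 0) \<le> \<bar>snd a\<bar>"
        by (simp add: dist_prod_def)
      also have "\<dots> < \<epsilon>" using bound[OF a(1,2)] a(3) \<epsilon> by simp
      finally show "\<exists>b\<in>X \<times> {0}. dist a b < \<epsilon>" using a by (intro bexI[of _ "(fst a, 0)"]) auto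
    next
      fix b :: "((real ^ 'n) \<times> real) \<times> real" assume b: "b \<in> X \<times> {0}"
      then obtain x where x: "x \<in> X" "b = (x, 0)" by auto
      obtain y where y: "y \<in> X" "d y \<le> radius_of H" "dist x y \<le> 2 * (pi - radius_of H)"
        using near_point_in_ball[OF x(1) R] by blast
      have "dist (y, g H y) b \<le> dist y x + \<bar>g H y\<bar>"
        unfolding x(2) dist_Pair_Pair
        using sqrt_sum_squares_le_sum_abs[of "dist y x" "g H y"] by simp
      also have "\<dots> < \<epsilon>" using y(3) elim(2) bound[OF y(1,2)] by (simp add: dist_commute)
      finally show "\<exists>a\<in>S H. dist a b < \<epsilon>"
        using y S[OF elim(3)] by (intro bexI[of _ "(y, g H y)"]) auto
    qed
  qed
qed

lemma lower_sheet_converges: "converges_uniformly (lower_sheet eps p) (X \<times> {0}) (at_right 0)"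
proof (rule converges_to_slice)
  fix H :: real assume "H > 0"
  then have H: "C_eps (Suc m) eps < H" by simp
  show "lower_sheet eps p H = {z. fst z \<in> X \<and> d (fst z) \<le> radius_of H \<and> snd z = mer H (d (fst z))}"
    by (rule lower_sheet_eq[OF H])
  show "0 \<le> mer H (d x) \<and> mer H (d x) \<le> 2 * height_of H" if "x \<in> X" "d x \<le> radius_of H" for x
    using meridian_range[OF H that] by simp
qed

lemma upper_sheet_converges: "converges_uniformly (upper_sheet eps p) (X \<times> {0}) (at_right 0)"
proof (rule converges_to_slice)
  fix H :: real assume "H > 0"
  then have H: "C_eps (Suc m) eps < H" by simp
  show "upper_sheet eps p H = {z. fst z \<in> X \<and> d (fst z) \<le> radius_of H \<and> snd z = 2 * height_of H - mer H (d (fst z))}"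
    by (rule upper_sheet_eq[OF H])
  show "0 \<le> 2 * height_of H - mer H (d x) \<and> 2 * height_of H - mer H (d x) \<le> 2 * height_of H" if "x \<in> X" "d x \<le> radius_of H" for x
    using meridian_range[OF H that] by simp
qed

end

theorem theorem1:
  fixes eps :: int and p :: "(real ^ 'n::finite) \<times> real"
  assumes "CARD('n) \<ge> 2"
    and "eps \<in> {-1, 1}"
    and "p \<in> space_form eps"
  shows "(eps = -1 \<longrightarrow> nested eps p (C_eps CARD('n) eps)) \<and>
    (eps = 1 \<longrightarrow>
       (\<exists>Cmin>0. \<forall>C\<ge>0. nested eps p C \<longleftrightarrow> C \<ge> Cmin) \<and>
       (\<exists>\<eta>>0. strict_mono_on {0<..<\<eta>} (sym_height CARD('n) eps)) \<and>
       (sym_height CARD('n) eps \<longlongrightarrow> 0) (at_right 0) \<and>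
       converges_uniformly (lower_sheet eps p) (space_form eps \<times> {0}) (at_right 0) \<and>
       converges_uniformly (upper_sheet eps p) (space_form eps \<times> {0}) (at_right 0))"
proof -
  define m where "m = CARD('n) - 1"
  have n: "CARD('n) = Suc m" and m: "m \<ge> 1" using assms(1) by (auto simp: m_def)
  interpret pointed_space_form eps m p
    using assms n m by unfold_locales auto
  have "nested eps p (C_eps (Suc m) eps)" if "eps = -1"
    by (rule hyperbolic_nested[OF that])
  moreover have
    "(\<exists>Cmin>0. \<forall>C\<ge>0. nested eps p C \<longleftrightarrow> C \<ge> Cmin) \<and>
     (\<exists>\<eta>>0. strict_mono_on {0<..<\<eta>} (sym_height (Suc m) eps)) \<and>
     (sym_height (Suc m) eps \<longlongrightarrow> 0) (at_right 0) \<and>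
     converges_uniformly (lower_sheet eps p) (space_form eps \<times> {0}) (at_right 0) \<and>
     converges_uniformly (upper_sheet eps p) (space_form eps \<times> {0}) (at_right 0)" if "eps = 1"
  proof -
    interpret pointed_sphere eps m p by unfold_locales (rule that)
    show ?thesis
      by (intro conjI nested_threshold height_eventually_increasing height_tendsto_zero
            lower_sheet_converges upper_sheet_converges)
  qed
  ultimately show ?thesis unfolding n by blast
qed

end
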